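(* Let $n\ge 2$, $\alpha\in\mathbb{R}$ and $0<p<\infty$. Then the harmonic Bergman–Besov space $b^p_{p\alpha-n}$ on the unit ball of $\mathbb{R}^n$ is contained in the weighted harmonic little Bloch space $b^\infty_{\alpha 0}$, i.e. $b^p_{p\alpha-n}\subset b^\infty_{\alpha 0}$.
   Context: Let $n\ge 2$, let $\mathbb{B}$ be the open unit ball of $\mathbb{R}^n$, $\nu$ the normalized Lebesgue measure on $\mathbb{B}$ ($\nu(\mathbb{B})=1$), and $h(\mathbb{B})$ the space of complex-valued harmonic functions on $\mathbb{B}$. For $\alpha\in\mathbb{R}$ let $d\nu_\alpha(x)=\frac1{V_\alpha}(1-|x|^2)^\alpha d\nu(x)$, where $V_\alpha$ is chosen so that $\nu_\alpha(\mathbb{B})=1$ if $\alpha>-1$, and $V_\alpha=1$ if $\alpha\le -1$; $L^p_\alpha$ is the Lebesgue class $L^p(\nu_\alpha)$, $0<p<\infty$. Let $L^\infty_\alpha=\{\varphi:(1-|x|^2)^\alpha\varphi(x)\in L^\infty(\mathbb{B})\}$ with norm $\|\varphi\|_{L^\infty_\alpha}=\|(1-|x|^2)^\alpha\varphi\|_{L^\infty}$. With the Pochhammer symbol $(a)_k=\Gamma(a+k)/\Gamma(a)$, for $\alpha\in\mathbb{R}$ and integers $k\ge0$ put $\gamma_k(\alpha)=\frac{(1+n/2+\alpha)_k}{(n/2)_k}$ if $\alpha>-(1+n/2)$, and $\gamma_k(\alpha)=\frac{((1)_k)^2}{(1-(n/2+\alpha))_k\,(n/2)_k}$ if $\alpha\le-(1+n/2)$.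 Every $f\in h(\mathbb{B})$ has a homogeneous expansion $f=\sum_{k\ge0}f_k$ with $f_k$ a homogeneous harmonic polynomial of degree $k$ (converging absolutely and uniformly on compact subsets of $\mathbb{B}$). For $s,t\in\mathbb{R}$ define $D^t_s f=\sum_{k\ge0}\frac{\gamma_k(s+t)}{\gamma_k(s)}f_k\in h(\mathbb{B})$ and $I^t_sf(x)=(1-|x|^2)^tD^t_sf(x)$. Harmonic Bergman–Besov space: for $\alpha\in\mathbb{R}$, $0<p<\infty$, $b^p_\alpha$ is the set of $f\in h(\mathbb{B})$ with $I^t_sf\in L^p_\alpha$ for some $s,t\in\mathbb{R}$ with $\alpha+pt>-1$ (it is known that this does not depend on the choice of such $s,t$). Weighted harmonic Bloch space: for $\alpha\in\mathbb{R}$, $b^\infty_\alpha$ is the set of $f\in h(\mathbb{B})$ with $I^t_sf\in L^\infty_\alpha$ for some $s,t\in\mathbb{R}$ with $\alpha+t>0$. Weighted harmonic little Bloch space: $b^\infty_{\alpha0}$ is the set of $f\in b^\infty_\alpha$ with $\lim_{|x|\to1^-}(1-|x|^2)^\alpha|I^t_sf(x)|=0$, where $s,t\in\mathbb{R}$ satisfy $\alpha+t>0$. It is known that both definitions are independent of the choice of such $s,t$. *)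

theory Defs
  imports "HOL-Analysis.Analysis" "HOL-Complex_Analysis.Complex_Analysis"
begin

text \<open>\<open>C\<^sup>2\<close> functions (\<open>f1\<close>, \<open>f2\<close> are the first and second derivatives) with vanishing
  Laplacian. The set \<open>S\<close> is meant to be open.\<close>

definition harmonic_on :: "'a::euclidean_space set \<Rightarrow> ('a \<Rightarrow> complex) \<Rightarrow> bool" where
  "harmonic_on S f \<longleftrightarrow>
     (\<exists>(f1 :: 'a \<Rightarrow> 'a \<Rightarrow>\<^sub>L complex) (f2 :: 'a \<Rightarrow> 'a \<Rightarrow>\<^sub>L 'a \<Rightarrow>\<^sub>L complex).
        (\<forall>x\<in>S. (f has_derivative blinfun_apply (f1 x)) (at x)) \<and>
        (\<forall>x\<in>S. (f1 has_derivative blinfun_apply (f2 x)) (at x)) \<and>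
        continuous_on S f2 \<and>
        (\<forall>x\<in>S. (\<Sum>b\<in>Basis. blinfun_apply (blinfun_apply (f2 x) b) b) = 0))"

definition homogeneous_harmonic_polynomial ::
    "nat \<Rightarrow> ('a::euclidean_space \<Rightarrow> complex) \<Rightarrow> bool" where
  "homogeneous_harmonic_polynomial k P \<longleftrightarrow>
     polynomial_function P \<and> (\<forall>c x. P (c *\<^sub>R x) = of_real (c ^ k) * P x) \<and> harmonic_on UNIV P"

text \<open>\<open>f = \<Sum>\<^sub>k F k\<close> on the unit ball, absolutely and uniformly on compact subsets. Every function that
  is harmonic on the ball has such an expansion, and only one: see
  \<open>homogeneous_expansion_unique\<close> below.\<close>

definition homogeneous_expansion ::
    "('a::euclidean_space \<Rightarrow> complex) \<Rightarrow> (nat \<Rightarrow> 'a \<Rightarrow> complex) \<Rightarrow> bool" where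
  "homogeneous_expansion f F \<longleftrightarrow>
     (\<forall>k. homogeneous_harmonic_polynomial k (F k)) \<and>
     (\<forall>x\<in>ball 0 1. (\<lambda>k. F k x) sums f x) \<and>
     (\<forall>K. compact K \<and> K \<subseteq> ball 0 1 \<longrightarrow>
        uniformly_convergent_on K (\<lambda>N x. \<Sum>k<N. norm (F k x)))"

lemma homogeneous_expansion_unique:
  fixes f :: "'a::euclidean_space \<Rightarrow> complex"
  assumes F: "homogeneous_expansion f F" and G: "homogeneous_expansion f G"
  shows "F = G"
proof -
  have hom: "F k (c *\<^sub>R x) = of_real (c ^ k) * F k x" "G k (c *\<^sub>R x) = of_real (c ^ k) * G k x"
    for k c x
    using F G by (auto simp: homogeneous_expansion_def homogeneous_harmonic_polynomial_def)
  have zero: "F k x = G k x" if x: "norm x < 1" for k x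
  proof (rule ccontr)
    assume neq: "F k x \<noteq> G k x"
    define a where "a = (\<lambda>j. F j x - G j x)"
    have sums0: "(\<lambda>j. a j * of_real c ^ j) sums 0" if "\<bar>c\<bar> \<le> 1" for c :: real
    proof -
      have "norm (c *\<^sub>R x) \<le> norm x"
        using that by (simp add: mult_left_le_one_le)
      hence "c *\<^sub>R x \<in> ball 0 1" using x by simp
      hence "(\<lambda>j. F j (c *\<^sub>R x) - G j (c *\<^sub>R x)) sums (f (c *\<^sub>R x) - f (c *\<^sub>R x))"
        using F G unfolding homogeneous_expansion_def by (intro sums_diff) blast+
      thus ?thesis by (simp add: hom a_def algebra_simps)
    qed
    have summ: "summable (\<lambda>j. a j * z ^ j)" if "norm z < 1" for z :: complex
      by (rule powser_inside[of a 1]) (use sums0[of 1] that in \<open>auto simp: sums_iff\<close>)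
    define h where "h = (\<lambda>z::complex. \<Sum>j. a j * z ^ j)"
    have h: "(\<lambda>j. a j * (z - 0) ^ j) sums h z" if "norm (z - 0) < 1" for z
      using summ that by (simp add: h_def summable_sums)
    have h0: "h (of_real c) = 0" if "\<bar>c\<bar> < 1" for c :: real
      using sums0[of c] that by (simp add: h_def sums_iff)
    have ak: "a k \<noteq> 0" using neq by (simp add: a_def)
    have "k > 0"
    proof (rule ccontr)
      assume "\<not> k > 0"
      thus False using ak h0[of 0] by (simp add: h_def)
    qed
    obtain s where s: "s > 0" "\<And>z. z \<in> cball 0 s - {0} \<Longrightarrow> h z \<noteq> 0"
      using powser_0_nonzero[of 1 0 a h k] h h0[of 0] ak \<open>k > 0\<close> by auto
    define d where "d = min s (1/2)"
    have d: "0 < d" "d < 1" "d \<le> s" using s(1) by (auto simp: d_def)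
    hence "complex_of_real d \<in> cball 0 s - {0}" by simp
    thus False using s(2)[of "of_real d"] h0[of d] d by auto
  qed
  have "F k x = G k x" for k x
  proof -
    define c where "c = 1 / (norm x + 1)"
    have c: "c > 0" by (simp add: c_def add_nonneg_pos)
    have "norm (c *\<^sub>R x) < 1" by (simp add: c_def divide_simps add_nonneg_pos)
    from zero[OF this, of k] show ?thesis using c by (simp add: hom)
  qed
  thus ?thesis by blast
qed

text \<open>In both branches the arguments of \<^const>\<open>pochhammer\<close> are positive.\<close>

definition gamma_coeff :: "nat \<Rightarrow> real \<Rightarrow> nat \<Rightarrow> real" where
  "gamma_coeff n \<alpha> k =
     (if \<alpha> > - (1 + real n / 2)
      then pochhammer (1 + real n / 2 + \<alpha>) k / pochhammer (real n / 2) k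
      else (pochhammer 1 k)\<^sup>2 / (pochhammer (1 - (real n / 2 + \<alpha>)) k * pochhammer (real n / 2) k))"

text \<open>The operators \<open>D\<^sub>s\<^sup>t\<close> and \<open>I\<^sub>s\<^sup>t\<close>, applied to the function with homogeneous
  components \<open>F k\<close>.\<close>

definition D_op :: "real \<Rightarrow> real \<Rightarrow> (nat \<Rightarrow> real^'n \<Rightarrow> complex) \<Rightarrow> real^'n \<Rightarrow> complex" where
  "D_op s t F x =
     (\<Sum>k. of_real (gamma_coeff CARD('n) (s + t) k / gamma_coeff CARD('n) s k) * F k x)"

definition I_op :: "real \<Rightarrow> real \<Rightarrow> (nat \<Rightarrow> real^'n \<Rightarrow> complex) \<Rightarrow> real^'n \<Rightarrow> complex" where
  "I_op s t F x = of_real ((1 - (norm x)\<^sup>2) powr t) * D_op s t F x"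

text \<open>Measures on the ball: all of them have \<^term>\<open>ball 0 1\<close> as their space, so values of
  functions outside the ball are irrelevant.\<close>

definition ball_measure :: "(real^'n) measure" where
  "ball_measure = uniform_measure (lebesgue_on (ball 0 1)) (ball 0 1)"

definition weight_const :: "'n::finite itself \<Rightarrow> real \<Rightarrow> real" where
  "weight_const _ \<alpha> =
     (if \<alpha> > -1 then (LINT x|(ball_measure :: (real^'n) measure). (1 - (norm x)\<^sup>2) powr \<alpha>) else 1)"

definition weighted_measure :: "real \<Rightarrow> (real^'n) measure" where
  "weighted_measure \<alpha> =
     density ball_measure (\<lambda>x. ennreal ((1 - (norm x)\<^sup>2) powr \<alpha> / weight_const TYPE('n) \<alpha>))"

definition Lp_class :: "real \<Rightarrow> 'a measure \<Rightarrow> ('a \<Rightarrow> complex) set" where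
  "Lp_class p M =
     {g. g \<in> borel_measurable M \<and> integrable M (\<lambda>x. norm (g x) powr p)}"

definition Linf_class :: "'a measure \<Rightarrow> ('a \<Rightarrow> complex) set" where
  "Linf_class M = {g. g \<in> borel_measurable M \<and> (\<exists>C. AE x in M. norm (g x) \<le> C)}"

definition weighted_Linf :: "real \<Rightarrow> (real^'n \<Rightarrow> complex) set" where
  "weighted_Linf \<alpha> =
     {g. (\<lambda>x. of_real ((1 - (norm x)\<^sup>2) powr \<alpha>) * g x) \<in> Linf_class ball_measure}"

definition bergman_besov :: "real \<Rightarrow> real \<Rightarrow> (real^'n \<Rightarrow> complex) set" where
  "bergman_besov p \<alpha> =
     {f. harmonic_on (ball 0 1) f \<and>
         (\<exists>F. homogeneous_expansion f F \<and>
           (\<exists>s t. \<alpha> + p * t > -1 \<and> I_op s t F \<in> Lp_class p (weighted_measure \<alpha>)))}"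

definition bloch :: "real \<Rightarrow> (real^'n \<Rightarrow> complex) set" where
  "bloch \<alpha> =
     {f. harmonic_on (ball 0 1) f \<and>
         (\<exists>F. homogeneous_expansion f F \<and>
           (\<exists>s t. \<alpha> + t > 0 \<and> I_op s t F \<in> weighted_Linf \<alpha>))}"

text \<open>The filter \<^term>\<open>filtercomap norm (at_left 1)\<close> expresses that \<open>norm x\<close> tends to
  1 from below.\<close>

definition little_bloch :: "real \<Rightarrow> (real^'n \<Rightarrow> complex) set" where
  "little_bloch \<alpha> =
     {f \<in> bloch \<alpha>.
         (\<exists>F. homogeneous_expansion f F \<and>
           (\<exists>s t. \<alpha> + t > 0 \<and>
             ((\<lambda>x. (1 - (norm x)\<^sup>2) powr \<alpha> * norm (I_op s t F x)) \<longlongrightarrow> 0)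
               (filtercomap norm (at_left 1))))}"

end

theory Submission
  imports Defs "HOL-Real_Asymp.Real_Asymp"
begin

text \<open>If \<open>f\<close> lies in the Bergman-Besov space via \<open>s\<close> and \<open>t\<close>, then \<open>p * (\<alpha> + t) > n - 1 > 0\<close>, so the
  same \<open>s\<close> and \<open>t\<close> can be used for the little Bloch space. The function \<open>u = D_op s t F\<close> is a locally
  uniform limit of harmonic polynomials and therefore has a mean value property, which bounds
  \<open>norm (u x) powr p * r ^ n\<close> by a constant times the integral of \<open>norm u powr p\<close> over
  \<open>cball x r\<close>, for every \<open>p > 0\<close>. With \<open>r = (1 - norm x) / 2\<close> the weight \<open>1 - (norm y)\<^sup>2\<close> is
  comparable to \<open>1 - (norm x)\<^sup>2\<close> on that ball, so
  \<open>((1 - (norm x)\<^sup>2) powr \<alpha> * norm (I_op s t F x)) powr p\<close> is at most a constant times the integral over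
  the shell \<open>norm y \<ge> (3 * norm x - 1) / 2\<close> of an integrable function, and this tends to 0 as
  \<open>norm x\<close> tends to 1.\<close>

subsection \<open>Mean value property with a bump function\<close>

text \<open>Translation along \<open>b\<close> by at most 1 keeps the unit ball, which carries the
  support of \<open>G\<close>, inside the cube, so the integral of the translate does not depend on
  \<open>h\<close>. Differentiating under the integral sign at \<open>h = 0\<close> gives the claim.
  This stands in for integration by parts without boundary terms.\<close>

lemma integral_directional_derivative_eq_0:
  fixes G G' :: "'a::euclidean_space \<Rightarrow> complex"
  assumes deriv: "\<And>y. ((\<lambda>h. G (y + h *\<^sub>R b)) has_vector_derivative G' y) (at 0)"
    and cont: "continuous_on UNIV G" "continuous_on UNIV G'"
    and supp: "\<And>y. norm y > 1 \<Longrightarrow> G y = 0"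
    and b: "b \<in> Basis"
  shows "integral (cbox (- (2 *\<^sub>R One)) (2 *\<^sub>R One)) G' = 0"
proof -
  let ?Q = "cbox (- (2 *\<^sub>R One)) (2 *\<^sub>R One) :: 'a set"
  let ?H = "\<lambda>h. integral ?Q (\<lambda>y. G (y + h *\<^sub>R b))"
  have const: "?H h = integral (cball 0 1) G" if h: "h \<in> {-1..1}" for h
  proof -
    let ?T = "cbox (- (2 *\<^sub>R One) + h *\<^sub>R b) (2 *\<^sub>R One + h *\<^sub>R b)"
    have sub: "cball 0 1 \<subseteq> ?T"
    proof
      fix y :: 'a assume y: "y \<in> cball 0 1"
      show "y \<in> ?T" unfolding mem_box
      proof (intro ballI)
        fix i :: 'a assume i: "i \<in> Basis"
        have "\<bar>y \<bullet> i\<bar> \<le> 1" using Basis_le_norm[OF i, of y] y by simp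
        moreover have "\<bar>h * (b \<bullet> i)\<bar> \<le> 1" using b i h by (auto simp: inner_Basis)
        ultimately show "(- (2 *\<^sub>R One) + h *\<^sub>R b) \<bullet> i \<le> y \<bullet> i \<and> y \<bullet> i \<le> (2 *\<^sub>R One + h *\<^sub>R b) \<bullet> i"
          using i by (auto simp: inner_add_left inner_diff_left abs_le_iff)
      qed
    qed
    have "?H h = integral ?Q (G \<circ> ((+) (h *\<^sub>R b)))"
      by (simp add: o_def add.commute)
    also have "\<dots> = integral ?T G" by (rule integral_shift_cbox_plus)
    also have "\<dots> = integral ?T (\<lambda>y. if y \<in> cball 0 1 then G y else 0)"
      using supp by (intro integral_cong) auto
    also have "\<dots> = integral (cball 0 1) G"
      by (simp only: integral_restrict_Int Int_absorb1[OF sub] Int_absorb2[OF sub])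
    finally show ?thesis .
  qed
  have dG: "((\<lambda>h. G (y + h *\<^sub>R b)) has_vector_derivative G' (y + h *\<^sub>R b)) (at h within S)" for y h S
  proof -
    have "((\<lambda>k. G ((y + h *\<^sub>R b) + k *\<^sub>R b)) has_vector_derivative G' (y + h *\<^sub>R b)) (at (h - h))"
      using deriv[of "y + h *\<^sub>R b"] by simp
    hence "(((\<lambda>k. G ((y + h *\<^sub>R b) + k *\<^sub>R b)) \<circ> (\<lambda>k. k - h)) has_vector_derivative 1 *\<^sub>R G' (y + h *\<^sub>R b)) (at h)"
      by (intro vector_diff_chain_at) (auto intro!: derivative_eq_intros)
    moreover have "(y + h *\<^sub>R b) + (k - h) *\<^sub>R b = y + k *\<^sub>R b" for k
      by (simp add: algebra_simps)
    ultimately show ?thesis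
      by (simp add: o_def has_vector_derivative_at_within)
  qed
  have "(?H has_vector_derivative integral ?Q (\<lambda>y. G' (y + 0 *\<^sub>R b))) (at 0 within {-1..1})"
  proof (rule leibniz_rule_vector_derivative)
    show "(\<lambda>y. G (y + h *\<^sub>R b)) integrable_on ?Q" for h
      by (intro integrable_continuous continuous_on_compose2[OF cont(1)] continuous_intros) auto
    show "continuous_on ({-1..1} \<times> ?Q) (\<lambda>(h, y). G' (y + h *\<^sub>R b))"
      unfolding split_beta
      by (intro continuous_on_compose2[OF cont(2)] continuous_intros) auto
  qed (use dG in auto)
  moreover have "(?H has_vector_derivative 0) (at 0 within {-1..1})"
  proof (rule has_vector_derivative_transform[of _ _ _ "\<lambda>_. integral (cball 0 1) G"])
    show "((\<lambda>_. integral (cball 0 1) G) has_vector_derivative 0) (at 0 within {-1..1})"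
      by (rule has_vector_derivative_const)
  qed (use const in auto)
  moreover have "at 0 within {-1..1::real} \<noteq> bot"
    by (subst at_within_Icc_at) auto
  ultimately have "integral ?Q (\<lambda>y. G' (y + 0 *\<^sub>R b)) = 0"
    by (meson vector_derivative_unique_within)
  thus ?thesis by simp
qed

text \<open>A polynomial cut off at the unit sphere is enough in place of a smooth bump: its square
  is continuously differentiable, and the gradient of the square is radial and again a multiple of
  \<open>bump\<close>.\<close>

definition bump :: "'a::real_normed_vector \<Rightarrow> real" where
  "bump y = max 0 (1 - (norm y)\<^sup>2)"

lemma bump_nonneg: "0 \<le> bump y" and bump_le_1: "bump y \<le> 1"
  and bump_eq_0: "norm y \<ge> 1 \<Longrightarrow> bump y = 0"
  by (auto simp: bump_def max_def dest: one_le_power[of _ 2])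

lemma continuous_on_bump [continuous_intros]:
  "continuous_on S f \<Longrightarrow> continuous_on S (\<lambda>x. bump (f x))"
  unfolding bump_def by (intro continuous_intros)

text \<open>Squaring removes the corner of \<open>max 0 s\<close> at 0, where the difference
  quotient is bounded by the increment. For this reason the square of \<open>bump\<close>, not
  \<open>bump\<close> itself, enters the divergence argument.\<close>

lemma has_real_derivative_max_0_power2:
  "((\<lambda>s::real. (max 0 s)\<^sup>2) has_real_derivative 2 * max 0 s) (at s)"
proof -
  consider "s > 0" | "s < 0" | "s = 0" by linarith
  thus ?thesis
  proof cases
    case 1
    have "((\<lambda>s. s\<^sup>2) has_real_derivative 2 * max 0 s) (at s)"
      using 1 by (auto intro!: derivative_eq_intros)
    thus ?thesis
      by (rule DERIV_cong_ev[THEN iffD1, rotated -1, OF _ refl])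
        (use 1 in \<open>auto intro: eventually_mono[OF eventually_nhds_in_open[of "{0<..}" s]]\<close>)
  next
    case 2
    have "((\<lambda>s. 0) has_real_derivative 2 * max 0 s) (at s)"
      using 2 by auto
    thus ?thesis
      by (rule DERIV_cong_ev[THEN iffD1, rotated -1, OF _ refl])
        (use 2 in \<open>auto intro: eventually_mono[OF eventually_nhds_in_open[of "{..<0}" s]]\<close>)
  next
    case 3
    have "((\<lambda>h::real. (max 0 h)\<^sup>2 / h) \<longlongrightarrow> 0) (at 0)"
    proof (rule Lim_null_comparison)
      show "\<forall>\<^sub>F h in at 0. norm ((max 0 h)\<^sup>2 / h) \<le> \<bar>h\<bar>"
        by (auto simp: power2_eq_square max_def eventually_at_filter)
    qed (auto intro!: tendsto_eq_intros)
    thus ?thesis using 3 by (simp add: DERIV_def)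
  qed
qed

lemma bump_power2_directional_derivative:
  fixes y b :: "'a::real_inner"
  shows "((\<lambda>h. (bump (y + h *\<^sub>R b))\<^sup>2) has_vector_derivative - 4 * (y \<bullet> b) * bump y) (at 0)"
proof -
  have "((\<lambda>h. 1 - (y + h *\<^sub>R b) \<bullet> (y + h *\<^sub>R b)) has_real_derivative - 2 * (y \<bullet> b)) (at 0)"
    unfolding inner_simps by (auto intro!: derivative_eq_intros simp: inner_commute)
  from DERIV_chain2[OF has_real_derivative_max_0_power2 this]
  show ?thesis
    by (simp add: has_real_derivative_iff_has_vector_derivative bump_def power2_norm_eq_inner mult_ac)
qed

text \<open>The weighted mean over radius \<open>r\<close> does not depend on \<open>r\<close>: as \<open>grad (bump\<^sup>2) = - 4 bump y\<close>, the
  divergence of \<open>bump\<^sup>2\<close> times the gradient of \<open>P\<close> at \<open>x + r y\<close> is \<open>- 4\<close> times the \<open>r\<close>-derivative of the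
  integrand.\<close>

lemma harmonic_bump_mean_value:
  fixes P :: "'a::euclidean_space \<Rightarrow> complex"
  assumes "harmonic_on UNIV P"
  defines "Q \<equiv> cbox (- (2 *\<^sub>R One)) (2 *\<^sub>R One)"
  shows "integral Q (\<lambda>y. bump y *\<^sub>R P (x + r *\<^sub>R y)) = integral Q bump *\<^sub>R P x"
proof -
  obtain f1 :: "'a \<Rightarrow> 'a \<Rightarrow>\<^sub>L complex" and f2 :: "'a \<Rightarrow> 'a \<Rightarrow>\<^sub>L 'a \<Rightarrow>\<^sub>L complex"
    where d1: "\<And>x. (P has_derivative blinfun_apply (f1 x)) (at x)"
      and d2: "\<And>x. (f1 has_derivative blinfun_apply (f2 x)) (at x)"
      and c2: "continuous_on UNIV f2"
      and lap: "\<And>x. (\<Sum>b\<in>Basis. f2 x b b) = 0"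
    using assms(1) unfolding harmonic_on_def by blast
  have cP: "continuous_on UNIV P" and c1: "continuous_on UNIV f1"
    using has_derivative_continuous[OF d1] has_derivative_continuous[OF d2]
    by (simp_all add: continuous_on_eq_continuous_at)
  note [continuous_intros] = continuous_on_compose2[OF cP _ subset_UNIV]
    continuous_on_compose2[OF c1 _ subset_UNIV] continuous_on_compose2[OF c2 _ subset_UNIV]
  have zero: "integral Q (\<lambda>y. bump y *\<^sub>R f1 (x + r *\<^sub>R y) y) = 0" for r
  proof -
    \<comment> \<open>\<open>G' b\<close> is the derivative in direction \<open>b\<close> of the
      squared bump times the partial derivative of \<open>P\<close> along \<open>b\<close> at
      \<open>x + r *\<^sub>R y\<close>. Each has integral 0; summed over the basis they form a
      divergence.\<close>
    define G' where "G' = (\<lambda>b y. (- 4 * (y \<bullet> b) * bump y) *\<^sub>R f1 (x + r *\<^sub>R y) b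
        + (bump y)\<^sup>2 *\<^sub>R (r *\<^sub>R f2 (x + r *\<^sub>R y) b b))"
    have cG': "continuous_on S (G' b)" for b S
      unfolding G'_def by (intro continuous_intros)
    have int0: "integral Q (G' b) = 0" if b: "b \<in> Basis" for b
      unfolding Q_def
    proof (rule integral_directional_derivative_eq_0[OF _ _ cG' _ b])
      fix y :: 'a
      have lin: "((\<lambda>h. x + r *\<^sub>R (y + h *\<^sub>R b)) has_vector_derivative r *\<^sub>R b) (at 0)"
        by (auto intro!: derivative_eq_intros)
      have "((\<lambda>h. f1 (x + r *\<^sub>R (y + h *\<^sub>R b)) b) has_vector_derivative
          (f2 (x + r *\<^sub>R y) (r *\<^sub>R b)) b) (at 0)"
      proof -
        have "(f1 has_derivative blinfun_apply (f2 (x + r *\<^sub>R y))) (at (x + r *\<^sub>R (y + 0 *\<^sub>R b)))"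
          using d2[of "x + r *\<^sub>R y"] by simp
        from vector_derivative_diff_chain_within[OF lin has_derivative_at_withinI[OF this]]
        have "((\<lambda>h. f1 (x + r *\<^sub>R (y + h *\<^sub>R b))) has_vector_derivative f2 (x + r *\<^sub>R y) (r *\<^sub>R b)) (at 0)"
          by (simp add: o_def)
        from bounded_linear.has_vector_derivative[OF blinfun.bounded_linear_left this]
        show ?thesis .
      qed
      hence "((\<lambda>h. f1 (x + r *\<^sub>R (y + h *\<^sub>R b)) b) has_vector_derivative
          r *\<^sub>R (f2 (x + r *\<^sub>R y) b) b) (at 0)"
        by (simp add: blinfun.scaleR_right blinfun.scaleR_left)
      from has_vector_derivative_scaleR[OF bump_power2_directional_derivative[of y b,
           folded has_real_derivative_iff_has_vector_derivative] this]
      show "((\<lambda>h. (bump (y + h *\<^sub>R b))\<^sup>2 *\<^sub>R f1 (x + r *\<^sub>R (y + h *\<^sub>R b)) b)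
          has_vector_derivative G' b y) (at 0)"
        by (simp add: G'_def add.commute)
    next
      show "continuous_on UNIV (\<lambda>y. (bump y)\<^sup>2 *\<^sub>R f1 (x + r *\<^sub>R y) b)"
        by (intro continuous_intros)
    qed (simp add: bump_eq_0)
    \<comment> \<open>Since the gradient of the squared bump is radial, the first-order terms
      assemble to the derivative of \<open>P\<close> in direction \<open>y\<close>, which is the
      derivative in \<open>r\<close>. The second-order terms sum to a multiple of the
      Laplacian.\<close>
    have "(\<Sum>b\<in>Basis. G' b y) = -4 *\<^sub>R (bump y *\<^sub>R f1 (x + r *\<^sub>R y) y)" for y
    proof -
      have "f1 (x + r *\<^sub>R y) y = f1 (x + r *\<^sub>R y) (\<Sum>b\<in>Basis. (y \<bullet> b) *\<^sub>R b)"
        by (simp add: euclidean_representation)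
      also have "\<dots> = (\<Sum>b\<in>Basis. (y \<bullet> b) *\<^sub>R f1 (x + r *\<^sub>R y) b)"
        by (simp add: blinfun.sum_right blinfun.scaleR_right)
      finally have "(\<Sum>b\<in>Basis. (- 4 * (y \<bullet> b) * bump y) *\<^sub>R f1 (x + r *\<^sub>R y) b)
          = -4 *\<^sub>R (bump y *\<^sub>R f1 (x + r *\<^sub>R y) y)"
        by (simp add: scaleR_sum_right mult_ac sum_negf)
      moreover have "(\<Sum>b\<in>Basis. (bump y)\<^sup>2 *\<^sub>R (r *\<^sub>R f2 (x + r *\<^sub>R y) b b)) = 0"
        by (simp only: lap scaleR_zero_right flip: scaleR_sum_right)
      ultimately show ?thesis
        unfolding G'_def sum.distrib by (simp only: add_0_right)
    qed
    hence "-4 *\<^sub>R integral Q (\<lambda>y. bump y *\<^sub>R f1 (x + r *\<^sub>R y) y) = integral Q (\<lambda>y. \<Sum>b\<in>Basis. G' b y)"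
      by (subst integral_cmul[symmetric]) simp
    also have "\<dots> = (\<Sum>b\<in>Basis. integral Q (G' b))"
      unfolding Q_def by (intro integral_sum integrable_continuous cG') auto
    also have "\<dots> = 0" by (simp add: int0)
    finally show ?thesis by simp
  qed
  define m where "m = (\<lambda>r. integral Q (\<lambda>y. bump y *\<^sub>R P (x + r *\<^sub>R y)))"
  have "(m has_vector_derivative integral Q (\<lambda>y. bump y *\<^sub>R f1 (x + r *\<^sub>R y) y)) (at r within UNIV)" for r
    unfolding m_def Q_def
  proof (rule leibniz_rule_vector_derivative)
    show "(\<lambda>y. bump y *\<^sub>R P (x + r *\<^sub>R y)) integrable_on cbox (- (2 *\<^sub>R One)) (2 *\<^sub>R One)" for r
      by (intro integrable_continuous continuous_intros)
    show "continuous_on (UNIV \<times> cbox (- (2 *\<^sub>R One)) (2 *\<^sub>R One)) (\<lambda>(r, y). bump y *\<^sub>R f1 (x + r *\<^sub>R y) y)"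
      unfolding split_beta by (intro continuous_intros)
    fix r and y :: 'a
    have "((\<lambda>r. x + r *\<^sub>R y) has_vector_derivative y) (at r)"
      by (auto intro!: derivative_eq_intros)
    from vector_derivative_diff_chain_within[OF this has_derivative_at_withinI[OF d1]]
    have "((\<lambda>r. P (x + r *\<^sub>R y)) has_vector_derivative f1 (x + r *\<^sub>R y) y) (at r)"
      by (simp add: o_def)
    thus "((\<lambda>r. bump y *\<^sub>R P (x + r *\<^sub>R y)) has_vector_derivative bump y *\<^sub>R f1 (x + r *\<^sub>R y) y) (at r within UNIV)"
      by (intro bounded_linear.has_vector_derivative[OF bounded_linear_scaleR_right])
  qed auto
  hence "(m has_vector_derivative 0) (at r within UNIV)" for r using zero by simp
  then obtain c where "\<And>r. m r = c"
    using has_vector_derivative_zero_constant[of UNIV m] by auto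
  \<comment> \<open>At radius 0 the integrand is \<open>bump y *\<^sub>R P x\<close>, so the
    constant value of \<open>m\<close> can be read off there.\<close>
  hence "m r = m 0" by simp
  moreover have "bump integrable_on Q"
    unfolding Q_def by (intro integrable_continuous continuous_intros)
  hence "((\<lambda>y. bump y *\<^sub>R P x) has_integral integral Q bump *\<^sub>R P x) Q"
    by (intro has_integral_scaleR_left integrable_integral)
  hence "m 0 = integral Q bump *\<^sub>R P x"
    by (simp add: m_def integral_unique)
  ultimately show ?thesis by (simp add: m_def)
qed

subsection \<open>Multipliers of homogeneous expansions\<close>

lemma gamma_coeff_pos: "n > 0 \<Longrightarrow> gamma_coeff n a k > 0"
  by (auto simp: gamma_coeff_def intro!: divide_pos_pos mult_pos_pos pochhammer_pos zero_less_power)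

text \<open>Passing from \<open>k\<close> to \<open>Suc k\<close> adds one linear factor to each
  Pochhammer symbol, so the ratio is a rational function of \<open>k\<close> whose numerator and
  denominator have equal degree and leading coefficient 1.\<close>

lemma gamma_coeff_ratio_tendsto_1:
  assumes "n > 0"
  shows "(\<lambda>k. gamma_coeff n a (Suc k) / gamma_coeff n a k) \<longlonglongrightarrow> 1"
proof (cases "a > - (1 + real n / 2)")
  case True
  have "pochhammer (1 + real n / 2 + a) k > 0" "pochhammer (real n / 2) k > 0" for k
    using True assms by (auto intro!: pochhammer_pos)
  hence "gamma_coeff n a (Suc k) / gamma_coeff n a k = (1 + real n / 2 + a + real k) / (real n / 2 + real k)" for k
    using True by (simp add: gamma_coeff_def pochhammer_Suc less_imp_neq[symmetric])
  moreover have "(\<lambda>k. (1 + real n / 2 + a + real k) / (real n / 2 + real k)) \<longlonglongrightarrow> 1"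
    by real_asymp
  ultimately show ?thesis by simp
next
  case False
  define b where "b = 1 - (real n / 2 + a)"
  have "pochhammer b k > 0" "pochhammer (real n / 2) k > 0" "pochhammer (1::real) k > 0" for k
    using False assms by (auto intro!: pochhammer_pos simp: b_def)
  hence "gamma_coeff n a (Suc k) / gamma_coeff n a k = (1 + real k)\<^sup>2 / ((b + real k) * (real n / 2 + real k))" for k
    using False
    by (simp add: gamma_coeff_def pochhammer_Suc less_imp_neq[symmetric] power_mult_distrib flip: b_def)
  moreover have "(\<lambda>k. (1 + real k)\<^sup>2 / ((b + real k) * (real n / 2 + real k))) \<longlonglongrightarrow> 1"
    by real_asymp
  ultimately show ?thesis by simp
qed

text \<open>The coefficients of \<open>D_op\<close> grow slower than any geometric sequence, so
  applying it loses no convergence in the open ball. This is the only property of them that the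
  later multiplier lemmas assume.\<close>

lemma summable_gamma_coeff_quotient:
  fixes q :: real
  assumes n: "n > 0" and q: "0 \<le> q" "q < 1"
  shows "summable (\<lambda>k. \<bar>gamma_coeff n a k / gamma_coeff n b k\<bar> * q ^ k)"
proof -
  define c where "c = (\<lambda>k. gamma_coeff n a k / gamma_coeff n b k)"
  have pos: "c k > 0" for k
    using gamma_coeff_pos[OF n] by (auto simp: c_def)
  have abs_c: "\<bar>gamma_coeff n a k / gamma_coeff n b k\<bar> = c k" for k
    using pos[of k] unfolding c_def by (rule abs_of_pos)
  have "(\<lambda>k. (gamma_coeff n a (Suc k) / gamma_coeff n a k) / (gamma_coeff n b (Suc k) / gamma_coeff n b k)) \<longlonglongrightarrow> 1 / 1"
    by (intro tendsto_divide gamma_coeff_ratio_tendsto_1 n) auto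
  moreover have "(gamma_coeff n a (Suc k) / gamma_coeff n a k) / (gamma_coeff n b (Suc k) / gamma_coeff n b k)
      = c (Suc k) / c k" for k
    by (simp add: c_def field_simps)
  ultimately have "(\<lambda>k. c (Suc k) / c k) \<longlonglongrightarrow> 1" by simp
  \<comment> \<open>The bound \<open>2 / (1 + q)\<close> exceeds the limit 1, yet its product with
    \<open>q\<close> is still less than 1, as the ratio test requires.\<close>
  moreover have "1 < 2 / (1 + q)" using q by simp
  ultimately have "eventually (\<lambda>k. c (Suc k) / c k < 2 / (1 + q)) sequentially"
    by (rule order_tendstoD)
  then obtain N where N: "\<And>k. k \<ge> N \<Longrightarrow> c (Suc k) / c k < 2 / (1 + q)"
    by (auto simp: eventually_sequentially)
  show ?thesis
  proof (rule summable_ratio_test[where c = "q * (2 / (1 + q))" and N = N])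
    show "q * (2 / (1 + q)) < 1" using q by (simp add: field_simps)
    fix k assume "k \<ge> N"
    hence "c (Suc k) \<le> 2 / (1 + q) * c k"
      using N[of k] pos[of k] by (simp add: pos_divide_less_eq)
    hence "q ^ Suc k * c (Suc k) \<le> q ^ Suc k * (2 / (1 + q) * c k)"
      using q by (intro mult_left_mono) auto
    thus "norm (\<bar>gamma_coeff n a (Suc k) / gamma_coeff n b (Suc k)\<bar> * q ^ Suc k)
        \<le> q * (2 / (1 + q)) * norm (\<bar>gamma_coeff n a k / gamma_coeff n b k\<bar> * q ^ k)"
      using q pos[of k] pos[of "Suc k"] unfolding abs_c by (simp add: mult_ac)
  qed
qed

text \<open>Homogeneity turns boundedness of the terms on a larger ball into geometric decay on
  \<open>cball 0 \<rho>\<close>: there \<open>F k x\<close> is \<open>q ^ k\<close> times the value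
  of \<open>F k\<close> at \<open>x / q\<close>. The Weierstrass test then absorbs the
  multipliers.\<close>

lemma homogeneous_expansion_multiplier_uniform_limit:
  fixes F :: "nat \<Rightarrow> 'a::euclidean_space \<Rightarrow> complex" and c :: "nat \<Rightarrow> real"
  assumes F: "homogeneous_expansion f F"
    and c: "\<And>q. \<lbrakk>0 \<le> q; q < 1\<rbrakk> \<Longrightarrow> summable (\<lambda>k. \<bar>c k\<bar> * q ^ k)"
    and \<rho>: "0 \<le> \<rho>" "\<rho> < 1"
  shows "uniform_limit (cball 0 \<rho>) (\<lambda>N x. \<Sum>k<N. of_real (c k) * F k x)
           (\<lambda>x. \<Sum>k. of_real (c k) * F k x) sequentially"
proof -
  \<comment> \<open>Any \<open>q\<close> strictly between \<rho> and 1 serves: \<open>q < 1\<close>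
    makes the majorant summable, and \<open>\<rho> < q\<close> keeps the dilated ball of radius
    \<open>\<rho> / q\<close> compactly inside the unit ball.\<close>
  define q where "q = (1 + \<rho>) / 2"
  have q: "0 < q" "q < 1" "\<rho> < q" using \<rho> by (auto simp: q_def)
  have "compact (cball (0::'a) (\<rho> / q))" "cball (0::'a) (\<rho> / q) \<subseteq> ball 0 1"
    using order.strict_trans1[of _ "\<rho> / q" 1] q by auto
  hence "uniformly_convergent_on (cball 0 (\<rho> / q)) (\<lambda>N x. \<Sum>k<N. norm (F k x))"
    using F unfolding homogeneous_expansion_def by blast
  hence "uniformly_Cauchy_on (cball 0 (\<rho> / q)) (\<lambda>N x. \<Sum>k<N. norm (F k x))"
    by (simp add: uniformly_convergent_eq_Cauchy)
  \<comment> \<open>Consecutive partial sums differ by a single term, so the Cauchy condition with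
    tolerance 1 bounds every late term by 1 on the dilated ball.\<close>
  then obtain N where N: "\<And>x k l. \<lbrakk>x \<in> cball 0 (\<rho> / q); k \<ge> N; l \<ge> N\<rbrakk> \<Longrightarrow>
      dist (\<Sum>k<k. norm (F k x)) (\<Sum>k<l. norm (F k x)) < 1"
    unfolding uniformly_Cauchy_on_def by (metis zero_less_one)
  have bound: "norm (F k x) \<le> q ^ k" if "k \<ge> N" "x \<in> cball 0 \<rho>" for k x
  proof -
    have "norm (F k ((1 / q) *\<^sub>R x)) < 1"
      using N[of "(1 / q) *\<^sub>R x" "Suc k" k] that q by (simp add: dist_norm divide_right_mono)
    moreover have "F k (q *\<^sub>R ((1 / q) *\<^sub>R x)) = of_real (q ^ k) * F k ((1 / q) *\<^sub>R x)"
      using F unfolding homogeneous_expansion_def homogeneous_harmonic_polynomial_def by blast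
    hence "norm (F k x) = q ^ k * norm (F k ((1 / q) *\<^sub>R x))"
      using q by (simp add: norm_mult norm_power)
    ultimately show ?thesis
      using q by (simp add: mult_left_le)
  qed
  show ?thesis
  proof (rule Weierstrass_m_test_ev)
    show "\<forall>\<^sub>F k in sequentially. \<forall>x\<in>cball 0 \<rho>. norm (of_real (c k) * F k x) \<le> \<bar>c k\<bar> * q ^ k"
      using bound by (auto simp: eventually_sequentially norm_mult intro!: exI[of _ N] mult_left_mono)
    show "summable (\<lambda>k. \<bar>c k\<bar> * q ^ k)" using c q by simp
  qed
qed

text \<open>This crude bound is the source of the factor \<open>2 * real DIM('a)\<close> in the
  radii below: a cube scaled by \<delta> fits into a ball of \<delta> times that radius.\<close>

lemma norm_le_in_cube:
  fixes z :: "'a::euclidean_space"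
  assumes "z \<in> cbox (- (2 *\<^sub>R One)) (2 *\<^sub>R One)"
  shows "norm z \<le> 2 * real DIM('a)"
proof -
  have "norm z \<le> (\<Sum>b\<in>Basis. \<bar>z \<bullet> b\<bar>)" by (rule norm_le_l1)
  also have "\<dots> \<le> (\<Sum>b\<in>(Basis::'a set). 2)"
    using assms by (intro sum_mono) (auto simp: mem_box abs_le_iff minus_le_iff)
  finally show ?thesis by simp
qed

lemma continuous_on_homogeneous_expansion:
  "homogeneous_expansion f F \<Longrightarrow> continuous_on S (F k)"
  by (auto simp: homogeneous_expansion_def homogeneous_harmonic_polynomial_def
      intro: continuous_on_polymonial_function)

lemma continuous_on_homogeneous_expansion_multiplier:
  fixes F :: "nat \<Rightarrow> 'a::euclidean_space \<Rightarrow> complex" and c :: "nat \<Rightarrow> real"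
  assumes F: "homogeneous_expansion f F"
    and c: "\<And>q. \<lbrakk>0 \<le> q; q < 1\<rbrakk> \<Longrightarrow> summable (\<lambda>k. \<bar>c k\<bar> * q ^ k)"
  shows "continuous_on (ball 0 1) (\<lambda>x. \<Sum>k. of_real (c k) * F k x)"
proof (rule continuous_at_imp_continuous_on, rule ballI)
  fix x :: 'a assume x: "x \<in> ball 0 1"
  define \<rho> where "\<rho> = (1 + norm x) / 2"
  have \<rho>: "0 \<le> \<rho>" "\<rho> < 1" "norm x < \<rho>" using x by (auto simp: \<rho>_def)
  have "continuous_on (cball 0 \<rho>) (\<lambda>x. \<Sum>k. of_real (c k) * F k x)"
    by (rule uniform_limit_theorem[OF _ homogeneous_expansion_multiplier_uniform_limit[OF F c \<rho>(1,2)] sequentially_bot])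
      (intro always_eventually allI continuous_intros continuous_on_homogeneous_expansion[OF F])
  thus "isCont (\<lambda>x. \<Sum>k. of_real (c k) * F k x) x"
    by (rule continuous_on_interior) (use \<rho> in simp)
qed

text \<open>The identity is linear, holds for every partial sum because each \<open>F k\<close> is
  harmonic, and passes to the uniform limit. Harmonicity of \<open>u\<close> itself need not be
  established. The condition on \<open>r\<close> keeps the scaled cube around \<open>x\<close> in a
  compact ball inside the unit ball.\<close>

lemma homogeneous_expansion_multiplier_mean_value:
  fixes F :: "nat \<Rightarrow> 'a::euclidean_space \<Rightarrow> complex" and c :: "nat \<Rightarrow> real"
  assumes F: "homogeneous_expansion f F"
    and c: "\<And>q. \<lbrakk>0 \<le> q; q < 1\<rbrakk> \<Longrightarrow> summable (\<lambda>k. \<bar>c k\<bar> * q ^ k)"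
    and r: "0 \<le> r" "norm x + r * (2 * real DIM('a)) < 1"
  defines "u \<equiv> (\<lambda>x. \<Sum>k. of_real (c k) * F k x)"
    and "Q \<equiv> cbox (- (2 *\<^sub>R One)) (2 *\<^sub>R One)"
  shows "integral Q (\<lambda>y. bump y *\<^sub>R u (x + r *\<^sub>R y)) = integral Q bump *\<^sub>R u x"
proof -
  define \<rho> where "\<rho> = norm x + r * (2 * real DIM('a))"
  have \<rho>: "0 \<le> \<rho>" "\<rho> < 1" "norm x \<le> \<rho>" using r by (auto simp: \<rho>_def)
  have inside: "x + r *\<^sub>R y \<in> cball 0 \<rho>" if "y \<in> Q" for y
  proof -
    have "norm (x + r *\<^sub>R y) \<le> norm x + r * norm y"
      using norm_triangle_ineq[of x "r *\<^sub>R y"] r by simp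
    thus ?thesis
      using norm_le_in_cube[of y] that mult_left_mono[of "norm y" "2 * real DIM('a)" r] r
      by (auto simp: \<rho>_def Q_def)
  qed
  let ?S = "\<lambda>N x. \<Sum>k<N. of_real (c k) * F k x"
  note [continuous_intros] = continuous_on_compose2[OF continuous_on_homogeneous_expansion[OF F] _ subset_UNIV]
  have lim: "uniform_limit (cball 0 \<rho>) ?S u sequentially"
    unfolding u_def using homogeneous_expansion_multiplier_uniform_limit[OF F c \<rho>(1,2)] .
  have "uniform_limit Q (\<lambda>N y. ?S N (x + r *\<^sub>R y)) (\<lambda>y. u (x + r *\<^sub>R y)) sequentially"
    by (rule uniform_limit_compose'[OF lim]) (use inside in auto)
  hence "uniform_limit Q (\<lambda>N y. bump y *\<^sub>R ?S N (x + r *\<^sub>R y)) (\<lambda>y. bump y *\<^sub>R u (x + r *\<^sub>R y)) sequentially"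
    unfolding uniform_limit_iff
  proof (intro allI impI, elim allE impE)
    fix e :: real
    assume "\<forall>\<^sub>F N in sequentially. \<forall>y\<in>Q. dist (?S N (x + r *\<^sub>R y)) (u (x + r *\<^sub>R y)) < e"
    thus "\<forall>\<^sub>F N in sequentially. \<forall>y\<in>Q. dist (bump y *\<^sub>R ?S N (x + r *\<^sub>R y)) (bump y *\<^sub>R u (x + r *\<^sub>R y)) < e"
    proof (eventually_elim, intro ballI)
      fix N y
      assume elim: "\<forall>y\<in>Q. dist (?S N (x + r *\<^sub>R y)) (u (x + r *\<^sub>R y)) < e" and y: "y \<in> Q"
      have "dist (bump y *\<^sub>R ?S N (x + r *\<^sub>R y)) (bump y *\<^sub>R u (x + r *\<^sub>R y))
          = bump y * dist (?S N (x + r *\<^sub>R y)) (u (x + r *\<^sub>R y))"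
        by (simp add: dist_norm bump_nonneg flip: scaleR_diff_right)
      also have "\<dots> \<le> dist (?S N (x + r *\<^sub>R y)) (u (x + r *\<^sub>R y))"
        using bump_nonneg[of y] bump_le_1[of y] by (intro mult_left_le_one_le) auto
      finally show "dist (bump y *\<^sub>R ?S N (x + r *\<^sub>R y)) (bump y *\<^sub>R u (x + r *\<^sub>R y)) < e"
        using elim y by force
    qed
  qed
  moreover have "continuous_on Q (\<lambda>y. bump y *\<^sub>R ?S N (x + r *\<^sub>R y))" for N
    by (intro continuous_intros)
  ultimately obtain I J where I: "\<And>N. ((\<lambda>y. bump y *\<^sub>R ?S N (x + r *\<^sub>R y)) has_integral I N) Q"
    and J: "((\<lambda>y. bump y *\<^sub>R u (x + r *\<^sub>R y)) has_integral J) Q" "I \<longlonglongrightarrow> J"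
    unfolding Q_def by (rule uniform_limit_integral_cbox) auto
  have "I = (\<lambda>N. integral Q bump *\<^sub>R ?S N x)"
  proof
    fix N
    have "I N = integral Q (\<lambda>y. \<Sum>k<N. of_real (c k) * (bump y *\<^sub>R F k (x + r *\<^sub>R y)))"
      using integral_unique[OF I] by (simp add: scaleR_sum_right)
    also have "\<dots> = (\<Sum>k<N. integral Q (\<lambda>y. of_real (c k) * (bump y *\<^sub>R F k (x + r *\<^sub>R y))))"
      unfolding Q_def by (intro integral_sum integrable_continuous continuous_intros) auto
    also have "\<dots> = (\<Sum>k<N. of_real (c k) * (integral Q bump *\<^sub>R F k x))"
    proof (intro sum.cong refl)
      fix k
      have "harmonic_on UNIV (F k)"
        using F by (auto simp: homogeneous_expansion_def homogeneous_harmonic_polynomial_def)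
      thus "integral Q (\<lambda>y. of_real (c k) * (bump y *\<^sub>R F k (x + r *\<^sub>R y)))
          = of_real (c k) * (integral Q bump *\<^sub>R F k x)"
        using harmonic_bump_mean_value[of "F k" x r] by (simp only: Q_def integral_mult_right)
    qed
    finally show "I N = integral Q bump *\<^sub>R ?S N x" by (simp add: scaleR_sum_right)
  qed
  moreover have "(\<lambda>N. integral Q bump *\<^sub>R ?S N x) \<longlonglongrightarrow> integral Q bump *\<^sub>R u x"
    using tendsto_uniform_limitI[OF lim, of x] \<rho> by (intro tendsto_intros) simp
  ultimately have "I \<longlonglongrightarrow> integral Q bump *\<^sub>R u x" by simp
  hence "J = integral Q bump *\<^sub>R u x"
    using J(2) LIMSEQ_unique by blast
  thus ?thesis using J(1) by (simp add: integral_unique)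
qed

subsection \<open>Local bounds by means of \<open>p\<close>-th powers\<close>

lemma integral_bump_pos:
  "integral (cbox (- (2 *\<^sub>R One)) (2 *\<^sub>R One)) (bump :: 'a::euclidean_space \<Rightarrow> real) > 0"
proof -
  let ?Q = "cbox (- (2 *\<^sub>R One)) (2 *\<^sub>R One) :: 'a set"
  have cont: "continuous_on ?Q bump" by (intro continuous_intros)
  have int: "(bump has_integral integral ?Q bump) ?Q"
    using integrable_continuous[OF cont] by (rule integrable_integral)
  have bump0: "bump (0::'a) \<noteq> 0" by (simp add: bump_def)
  have 0: "(0::'a) \<in> box (- (2 *\<^sub>R One)) (2 *\<^sub>R One)"
    unfolding mem_box by simp
  have "integral ?Q (bump :: 'a \<Rightarrow> real) \<noteq> 0"
  proof
    assume "integral ?Q (bump :: 'a \<Rightarrow> real) = 0"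
    with int have h0: "(bump has_integral 0) ?Q" by (simp only:)
    have ne: "box (- (2 *\<^sub>R One)) (2 *\<^sub>R One) \<noteq> ({} :: 'a set)"
      using 0 by (rule ex_in_conv[THEN iffD1, OF exI])
    have in_Q: "0 \<in> ?Q" unfolding mem_box by simp
    have "bump (0::'a) = 0"
      by (rule has_integral_0_cbox_imp_0[OF cont _ h0 ne in_Q]) (rule bump_nonneg)
    thus False using bump0 by contradiction
  qed
  moreover have "integral ?Q (bump :: 'a \<Rightarrow> real) \<ge> 0"
    by (rule has_integral_nonneg[OF int]) (rule bump_nonneg)
  ultimately show ?thesis by simp
qed

lemma cube_subset_cball:
  fixes y :: "'a::euclidean_space"
  assumes "\<delta> > 0"
  shows "cbox (y - (2 * \<delta>) *\<^sub>R One) (y + (2 * \<delta>) *\<^sub>R One) \<subseteq> cball y (\<delta> * (2 * real DIM('a)))"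
proof
  fix v assume v: "v \<in> cbox (y - (2 * \<delta>) *\<^sub>R One) (y + (2 * \<delta>) *\<^sub>R One)"
  define z where "z = (1 / \<delta>) *\<^sub>R (v - y)"
  have "z \<in> cbox (- (2 *\<^sub>R One)) (2 *\<^sub>R One)"
    using v assms by (auto simp: z_def mem_box inner_simps field_simps)
  hence "norm z \<le> 2 * real DIM('a)" by (rule norm_le_in_cube)
  moreover have "v = y + \<delta> *\<^sub>R z" using assms by (simp add: z_def)
  ultimately show "v \<in> cball y (\<delta> * (2 * real DIM('a)))"
    using assms by (simp add: dist_norm)
qed

text \<open>If \<open>t > a / 2\<close>, then \<open>(2 / a) powr p * t powr p\<close> is at least 1
  and the last term alone dominates \<open>K * a\<close>. The lemma trades a first power for a
  \<open>p\<close>-th power, at the price of a term \<open>a / 2\<close> that can be absorbed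
  later.\<close>

lemma le_half_plus_powr:
  fixes a t K p :: real
  assumes "0 < a" "0 \<le> t" "t \<le> K * a" "0 < p"
  shows "t \<le> a / 2 + K * a * (2 / a) powr p * t powr p"
proof (cases "t \<le> a / 2")
  case True
  have "0 \<le> K * a" using assms by linarith
  hence "0 \<le> K * a * (2 / a) powr p * t powr p" by simp
  thus ?thesis using True by linarith
next
  case False
  have "1 \<le> (2 / a * t) powr p"
    using False assms by (intro ge_one_powr_ge_zero) (auto simp: field_simps)
  also have "\<dots> = (2 / a) powr p * t powr p"
    using assms by (intro powr_mult)
  finally have "1 \<le> (2 / a) powr p * t powr p" .
  hence "K * a * 1 \<le> K * a * ((2 / a) powr p * t powr p)"
    using assms by (intro mult_left_mono) auto
  thus ?thesis using assms by (simp add: mult_ac)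
qed

text \<open>With \<open>a = norm (u y)\<close>, the mean value identity gives \<open>a * W\<close>
  at most the integral of \<open>bump\<close> times \<open>norm u\<close>. Splitting the integrand
  by \<open>le_half_plus_powr\<close> leaves \<open>W * (a / 2)\<close>, absorbed on the left, and
  an integral of \<open>norm u powr p\<close>. Rescaling the cube produces the factor
  \<open>\<delta> ^ DIM('a)\<close>.\<close>

lemma mean_value_local_maximum_bound:
  fixes u :: "'a::euclidean_space \<Rightarrow> complex" and p K :: real
  defines "Q \<equiv> cbox (- (2 *\<^sub>R One)) (2 *\<^sub>R One)"
  assumes p: "p > 0" and \<delta>: "\<delta> > 0" and uy: "u y \<noteq> 0"
    and cont: "continuous_on (cball y (\<delta> * (2 * real DIM('a)))) u"
    and bound: "\<And>z. z \<in> cball y (\<delta> * (2 * real DIM('a))) \<Longrightarrow> norm (u z) \<le> K * norm (u y)"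
    and mv: "integral Q (\<lambda>z. bump z *\<^sub>R u (y + \<delta> *\<^sub>R z)) = integral Q bump *\<^sub>R u y"
  shows "norm (u y) powr p * \<delta> ^ DIM('a) \<le> 2 * K * 2 powr p / integral Q (bump :: 'a \<Rightarrow> real) *
           integral (cbox (y - (2 * \<delta>) *\<^sub>R One) (y + (2 * \<delta>) *\<^sub>R One)) (\<lambda>z. norm (u z) powr p)"
proof -
  let ?C = "cbox (y - (2 * \<delta>) *\<^sub>R One) (y + (2 * \<delta>) *\<^sub>R One)"
  define a where "a = norm (u y)"
  define W where "W = integral Q (bump :: 'a \<Rightarrow> real)"
  define c where "c = K * a * (2 / a) powr p"
  have a: "a > 0" using uy by (simp add: a_def)
  have W: "W > 0" using integral_bump_pos by (simp add: W_def Q_def)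
  have inside: "y + \<delta> *\<^sub>R z \<in> cball y (\<delta> * (2 * real DIM('a)))" if "z \<in> Q" for z
    using norm_le_in_cube[of z] that \<delta> by (simp add: Q_def dist_norm)
  have "a \<le> K * a" using bound[of y] \<delta> by (simp add: a_def)
  hence K: "K \<ge> 1" using a by simp
  hence c: "c \<ge> 0" using a by (simp add: c_def)
  have contQ: "continuous_on Q (\<lambda>z. u (y + \<delta> *\<^sub>R z))"
    by (rule continuous_on_compose2[OF cont]) (use inside in \<open>auto intro!: continuous_intros\<close>)
  have contp: "continuous_on Q (\<lambda>z. norm (u (y + \<delta> *\<^sub>R z)) powr p)"
    by (rule continuous_on_powr') (use contQ p in \<open>auto intro!: continuous_intros\<close>)
  have contC: "continuous_on ?C (\<lambda>z. norm (u z) powr p)"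
    by (rule continuous_on_powr')
      (use continuous_on_subset[OF cont cube_subset_cball[OF \<delta>]] p in \<open>auto intro!: continuous_intros\<close>)
  have int: "f integrable_on Q" if "continuous_on Q f" for f :: "'a \<Rightarrow> real"
    using that unfolding Q_def by (rule integrable_continuous)
  define J where "J = integral Q (\<lambda>z. norm (u (y + \<delta> *\<^sub>R z)) powr p)"
  have "a * W = norm (integral Q (\<lambda>z. bump z *\<^sub>R u (y + \<delta> *\<^sub>R z)))"
    using mv W by (simp add: a_def W_def)
  \<comment> \<open>The weight stays on the first term, so that this term integrates to exactly half
    of the left-hand side; on the second term it is estimated by 1.\<close>
  also have "\<dots> \<le> integral Q (\<lambda>z. bump z * (a / 2) + c * norm (u (y + \<delta> *\<^sub>R z)) powr p)"
  proof (rule integral_norm_bound_integral)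
    show "(\<lambda>z. bump z *\<^sub>R u (y + \<delta> *\<^sub>R z)) integrable_on Q"
      unfolding Q_def by (intro integrable_continuous continuous_intros contQ[unfolded Q_def])
    show "(\<lambda>z. bump z * (a / 2) + c * norm (u (y + \<delta> *\<^sub>R z)) powr p) integrable_on Q"
      by (intro int continuous_intros contp)
    fix z assume z: "z \<in> Q"
    let ?t = "norm (u (y + \<delta> *\<^sub>R z))"
    have "?t \<le> a / 2 + c * ?t powr p"
      unfolding c_def by (rule le_half_plus_powr) (use a p bound[OF inside[OF z]] in \<open>auto simp: a_def\<close>)
    hence "bump z * ?t \<le> bump z * (a / 2 + c * ?t powr p)"
      by (intro mult_left_mono bump_nonneg)
    also have "\<dots> \<le> bump z * (a / 2) + c * ?t powr p"
      using c mult_right_mono[OF bump_le_1[of z], of "c * ?t powr p"] by (simp add: distrib_left)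
    finally show "norm (bump z *\<^sub>R u (y + \<delta> *\<^sub>R z)) \<le> bump z * (a / 2) + c * ?t powr p"
      by (simp add: bump_nonneg)
  qed
  also have "\<dots> = W * (a / 2) + c * J"
    unfolding W_def J_def
    by (subst integral_add) (auto intro!: int continuous_intros contp)
  finally have "a * W \<le> 2 * (c * J)" by (simp add: mult.commute)
  also have "\<dots> = a * (2 * K * (2 / a) powr p * J)" by (simp add: c_def mult_ac)
  finally have "W \<le> 2 * K * (2 / a) powr p * J" using a by (subst (asm) mult_le_cancel_left_pos)
  also have "(2 / a) powr p = 2 powr p / a powr p" using a by (simp add: powr_divide)
  finally have main: "a powr p \<le> 2 * K * 2 powr p / W * J"
    using a W by (simp add: pos_le_divide_eq mult_ac)
  have "((\<lambda>z. norm (u (\<delta> *\<^sub>R z + y)) powr p) has_integral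
      integral ?C (\<lambda>z. norm (u z) powr p) /\<^sub>R \<delta> ^ DIM('a))
      (cbox (((y - (2 * \<delta>) *\<^sub>R One) - y) /\<^sub>R \<delta>) (((y + (2 * \<delta>) *\<^sub>R One) - y) /\<^sub>R \<delta>))"
    using has_integral_affinity'[OF integrable_integral[OF integrable_continuous[OF contC]] \<delta>] .
  moreover have "((y - (2 * \<delta>) *\<^sub>R One) - y) /\<^sub>R \<delta> = - (2 *\<^sub>R One)"
    "((y + (2 * \<delta>) *\<^sub>R One) - y) /\<^sub>R \<delta> = 2 *\<^sub>R One" using \<delta> by auto
  ultimately have "J = integral ?C (\<lambda>z. norm (u z) powr p) /\<^sub>R \<delta> ^ DIM('a)"
    unfolding J_def Q_def by (intro integral_unique) (simp only: add.commute[of y])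
  hence "J * \<delta> ^ DIM('a) = integral ?C (\<lambda>z. norm (u z) powr p)"
    using \<delta> by simp
  moreover have "a powr p * \<delta> ^ DIM('a) \<le> 2 * K * 2 powr p / W * J * \<delta> ^ DIM('a)"
    using main \<delta> by (intro mult_right_mono) auto
  ultimately show ?thesis by (simp add: a_def W_def mult.assoc)
qed

text \<open>For \<open>p < 1\<close> the mean value property does not bound \<open>norm (u x) powr p\<close> by the average of
  \<open>norm u powr p\<close> directly. Moving to a maximum of \<open>norm (u y) powr p * (r - dist x y) ^ n\<close> makes
  \<open>norm u\<close> comparable on the surrounding half ball to its value at the centre.\<close>

lemma mean_value_imp_powr_bound:
  fixes p :: real
  defines "Q \<equiv> cbox (- (2 *\<^sub>R One)) (2 *\<^sub>R One) :: 'a::euclidean_space set"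
  assumes p: "p > 0"
  shows "\<exists>C>0. \<forall>(u :: 'a \<Rightarrow> complex) x r. r > 0 \<longrightarrow> continuous_on (cball x r) u \<longrightarrow>
       (\<forall>y \<delta>. \<delta> > 0 \<longrightarrow> cball y (\<delta> * (2 * real DIM('a))) \<subseteq> cball x r \<longrightarrow>
          integral Q (\<lambda>z. bump z *\<^sub>R u (y + \<delta> *\<^sub>R z)) = integral Q bump *\<^sub>R u y) \<longrightarrow>
       (\<exists>a b. cbox a b \<subseteq> cball x r \<and>
         norm (u x) powr p * r ^ DIM('a) \<le> C * integral (cbox a b) (\<lambda>z. norm (u z) powr p))"
proof (rule exI, intro conjI allI impI)
  define n where "n = DIM('a)"
  have n: "n > 0" by (simp add: n_def)
  \<comment> \<open>On the half ball around the maximum point the distance factor drops by at most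
    one half, which costs \<open>2 ^ n\<close> for \<open>norm u powr p\<close> and hence
    \<open>2 powr (n / p)\<close> for \<open>norm u\<close>.\<close>
  define K :: real where "K = 2 powr (n / p)"
  define B where "B = 2 * K * 2 powr p / integral Q (bump :: 'a \<Rightarrow> real)"
  define C where "C = B * (4 * real n) ^ n"
  have W: "integral Q (bump :: 'a \<Rightarrow> real) > 0"
    unfolding Q_def by (rule integral_bump_pos)
  show "C > 0" using W n by (simp add: C_def B_def K_def)
  fix u :: "'a \<Rightarrow> complex" and x r
  assume r: "r > 0" and cont: "continuous_on (cball x r) u"
    and mv': "\<forall>y \<delta>. \<delta> > 0 \<longrightarrow> cball y (\<delta> * (2 * real DIM('a))) \<subseteq> cball x r \<longrightarrow>
          integral Q (\<lambda>z. bump z *\<^sub>R u (y + \<delta> *\<^sub>R z)) = integral Q bump *\<^sub>R u y"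
  note mv = mv'[rule_format]
  show "\<exists>a b. cbox a b \<subseteq> cball x r \<and>
         norm (u x) powr p * r ^ DIM('a) \<le> C * integral (cbox a b) (\<lambda>z. norm (u z) powr p)"
  proof (cases "u x = 0")
    case True
    have "cbox x x \<subseteq> cball x r" using r by simp
    thus ?thesis using True by (intro exI[of _ x]) simp
  next
    case False
    define \<phi> where "\<phi> = (\<lambda>y. norm (u y) powr p * (r - dist x y) ^ n)"
    have "continuous_on (cball x r) \<phi>"
      unfolding \<phi>_def
      by (intro continuous_intros continuous_on_powr') (use cont p in \<open>auto intro!: continuous_intros\<close>)
    moreover have "cball x r \<noteq> {}" using r by simp
    ultimately obtain y where y: "y \<in> cball x r" and max: "\<And>z. z \<in> cball x r \<Longrightarrow> \<phi> z \<le> \<phi> y"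
      using continuous_attains_sup[of "cball x r" \<phi>] by auto
    \<comment> \<open>Positivity at the centre carries over to the maximum, so \<open>u\<close> does
      not vanish at \<open>y\<close> and \<open>y\<close> lies off the boundary sphere, which makes
      \<rho> positive.\<close>
    have "\<phi> x > 0" using False r by (simp add: \<phi>_def)
    hence "\<phi> y > 0" using max[of x] r by simp
    define \<rho> where "\<rho> = r - dist x y"
    have uy: "u y \<noteq> 0" and "\<rho> \<noteq> 0"
      using \<open>\<phi> y > 0\<close> n by (auto simp: \<phi>_def \<rho>_def zero_power)
    moreover have "\<rho> \<ge> 0" using y by (simp add: \<rho>_def)
    ultimately have \<rho>: "\<rho> > 0" by simp
    \<comment> \<open>This scale makes the ball enclosing the cube of half-side
      \<open>2 * \<delta>\<close> exactly the half ball of radius \<open>\<rho> / 2\<close>. It also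
      accounts for the factor \<open>(4 * real n) ^ n\<close> in \<open>C\<close>.\<close>
    define \<delta> where "\<delta> = \<rho> / (4 * real n)"
    have \<delta>: "\<delta> > 0" "\<delta> * (2 * real DIM('a)) = \<rho> / 2" "\<rho> = (4 * real n) * \<delta>"
      using \<rho> n by (simp_all add: \<delta>_def flip: n_def)
    have near: "z \<in> cball x r" "r - dist x z \<ge> \<rho> / 2" if "z \<in> cball y (\<rho> / 2)" for z
      using that \<rho> dist_triangle[of x z y] by (auto simp: \<rho>_def)
    have "norm (u z) \<le> K * norm (u y)" if z: "z \<in> cball y (\<rho> / 2)" for z
    proof -
      have "norm (u z) powr p * (\<rho> / 2) ^ n \<le> \<phi> z"
        unfolding \<phi>_def using near[OF z] \<rho> by (intro mult_left_mono power_mono) auto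
      also have "\<dots> \<le> \<phi> y" using max near[OF z] by blast
      also have "\<dots> = norm (u y) powr p * 2 ^ n * (\<rho> / 2) ^ n"
        by (simp add: \<phi>_def \<rho>_def power_divide)
      finally have "norm (u z) powr p \<le> norm (u y) powr p * 2 ^ n" using \<rho> by simp
      also have "\<dots> = (K * norm (u y)) powr p"
        using p by (simp add: K_def powr_mult powr_powr powr_realpow)
      finally have "norm (u z) powr p \<le> (K * norm (u y)) powr p" .
      moreover have "0 \<le> K * norm (u y)" by (simp add: K_def)
      ultimately show ?thesis
        using powr_less_mono2[OF p] by (metis not_less)
    qed
    moreover have half_ball: "cball y (\<rho> / 2) \<subseteq> cball x r" using near(1) by blast
    ultimately have bound: "norm (u y) powr p * \<delta> ^ n \<le> B *
        integral (cbox (y - (2 * \<delta>) *\<^sub>R One) (y + (2 * \<delta>) *\<^sub>R One)) (\<lambda>z. norm (u z) powr p)"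
      unfolding B_def Q_def n_def \<delta>(2)[symmetric]
      by (intro mean_value_local_maximum_bound p \<delta>(1) uy mv[unfolded Q_def]
          continuous_on_subset[OF cont] half_ball[folded \<delta>(2)]) blast
    have "norm (u x) powr p * r ^ n = \<phi> x" by (simp add: \<phi>_def)
    also have "\<dots> \<le> \<phi> y" using max r by simp
    also have "\<dots> = (4 * real n) ^ n * (norm (u y) powr p * \<delta> ^ n)"
      by (simp add: \<phi>_def power_mult_distrib flip: \<rho>_def) (simp add: \<delta>(3) power_mult_distrib)
    also have "\<dots> \<le> (4 * real n) ^ n * (B * integral (cbox (y - (2 * \<delta>) *\<^sub>R One) (y + (2 * \<delta>) *\<^sub>R One)) (\<lambda>z. norm (u z) powr p))"
      by (intro mult_left_mono bound) auto
    finally have "norm (u x) powr p * r ^ n \<le> C * integral (cbox (y - (2 * \<delta>) *\<^sub>R One) (y + (2 * \<delta>) *\<^sub>R One)) (\<lambda>z. norm (u z) powr p)"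
      by (simp add: C_def mult_ac)
    moreover have "cbox (y - (2 * \<delta>) *\<^sub>R One) (y + (2 * \<delta>) *\<^sub>R One) \<subseteq> cball x r"
      using cube_subset_cball[OF \<delta>(1), of y] half_ball unfolding \<delta>(2) by (rule subset_trans)
    ultimately show ?thesis unfolding n_def by blast
  qed
qed

subsection \<open>Weighted measures on the ball\<close>

lemma dyadic_bracket:
  fixes d :: real
  assumes "0 < d" "d \<le> 1"
  obtains j where "(1/2) ^ Suc j < d" "d \<le> (1/2) ^ j"
proof -
  define P where "P = (\<lambda>j. (1/2 :: real) ^ Suc j < d)"
  obtain i where i: "(1/2 :: real) ^ i < d" using real_arch_pow_inv[of d "1/2"] assms by auto
  have "(1/2 :: real) ^ Suc i \<le> (1/2) ^ i" by simp
  hence "P i" using i unfolding P_def by (rule le_less_trans)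
  define j where "j = (LEAST j. P j)"
  have "P j" unfolding j_def using \<open>P i\<close> by (rule LeastI)
  moreover have "d \<le> (1/2) ^ j"
  proof (cases j)
    case 0
    thus ?thesis using assms by simp
  next
    case (Suc k)
    hence "\<not> P k" using not_less_Least[of k P] by (simp add: j_def)
    thus ?thesis using Suc by (simp add: P_def)
  qed
  ultimately show ?thesis using that by (simp add: P_def)
qed

text \<open>The volume scales as \<open>r ^ n\<close>, and Bernoulli's inequality bounds
  \<open>1 - r ^ n\<close> by \<open>n * (1 - r)\<close>.\<close>

lemma content_ball_shell_le:
  assumes "0 \<le> r" "r \<le> 1"
  shows "measure lebesgue (ball (0::'a::euclidean_space) 1 - ball 0 r)
    \<le> measure lebesgue (ball (0::'a) 1) * (real DIM('a) * (1 - r))"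
proof -
  let ?n = "DIM('a)"
  have "measure lebesgue (ball (0::'a) 1 - ball 0 r)
      = measure lebesgue (ball (0::'a) 1) - measure lebesgue (ball (0::'a) r)"
    using assms by (intro measurable_measure_Diff) auto
  also have "\<dots> = measure lebesgue (ball (0::'a) 1) * (1 - r ^ ?n)"
    using content_ball_conv_unit_ball[of r "0::'a"] assms by (simp add: algebra_simps)
  also have "1 - r ^ ?n \<le> real ?n * (1 - r)"
    using Bernoulli_inequality[of "r - 1" ?n] assms by (simp add: algebra_simps)
  finally show ?thesis by (simp add: mult_left_mono)
qed

lemma borel_measurable_ball_weight:
  "(\<lambda>x::'a::euclidean_space. (1 - (norm x)\<^sup>2) powr a) \<in> borel_measurable (lebesgue_on S)"
  by (intro measurable_restrict_space1 measurable_completion) measurable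

lemma norm_power2_less_1: "norm x < 1 \<Longrightarrow> (norm x)\<^sup>2 < 1"
  by (simp add: abs_square_less_1)

text \<open>For \<open>a \<le> 0\<close> the weight is at most \<open>(2 powr - a) ^ Suc j\<close> on the dyadic shell
  \<open>(1/2) ^ Suc j < 1 - norm x \<le> (1/2) ^ j\<close>, whose measure is \<open>O((1/2) ^ j)\<close>.\<close>

lemma integrable_ball_weight:
  fixes a :: real
  assumes "a > -1"
  shows "integrable (lebesgue_on (ball (0::'a::euclidean_space) 1)) (\<lambda>x. (1 - (norm x)\<^sup>2) powr a)"
proof -
  let ?B = "ball (0::'a) 1"
  \<comment> \<open>The base \<open>1 - (norm x)\<^sup>2\<close> lies in (0, 1], so lowering the
    exponent only enlarges the weight. A nonpositive exponent turns a lower bound for the base into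
    an upper bound for the power, and \<open>b > -1\<close> gives \<open>q < 2\<close>, hence a
    convergent series in \<open>q / 2\<close>.\<close>
  define b where "b = min a 0"
  define q where "q = (1/2 :: real) powr b"
  \<comment> \<open>These shells are nested instead of disjoint. For an upper bound this is
    harmless: the single term with the bracketing index already dominates the weight at
    \<open>x\<close>.\<close>
  define A where "A = (\<lambda>j::nat. ?B - ball 0 (1 - (1/2) ^ j))"
  define \<omega> where "\<omega> = measure lebesgue ?B"
  have A: "A j \<in> sets lebesgue" for j by (simp add: A_def)
  have b: "-1 < b" "b \<le> 0" "b \<le> a" using assms by (auto simp: b_def)
  have q: "0 < q" "q < 2"
  proof -
    have "q = 2 powr (- b)" by (simp add: q_def powr_minus powr_divide inverse_eq_divide)
    also have "\<dots> < 2 powr 1" using b by (intro powr_less_mono) auto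
    finally show "q < 2" by simp
  qed (simp add: q_def)
  have pow: "(1 - (norm x)\<^sup>2) powr a \<le> q ^ Suc j" if x: "norm x < 1" "(1/2) ^ Suc j < 1 - norm x"
    for x :: 'a and j
  proof -
    have le: "1 - norm x \<le> 1 - (norm x)\<^sup>2"
      using x by (simp add: power2_eq_square mult_left_le)
    have "(1 - (norm x)\<^sup>2) powr a \<le> (1 - (norm x)\<^sup>2) powr b"
      using le x b by (intro powr_mono') auto
    also have "\<dots> \<le> ((1/2) ^ Suc j) powr b"
      using le x b by (intro powr_mono2') (auto simp del: power_Suc)
    also have "\<dots> = q ^ Suc j"
      by (simp add: q_def powr_power powr_powr mult.commute flip: powr_realpow del: power_Suc)
    finally show ?thesis .
  qed
  have "(\<integral>\<^sup>+x. ennreal ((1 - (norm x)\<^sup>2) powr a) \<partial>lebesgue_on ?B)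
      = (\<integral>\<^sup>+x. ennreal ((1 - (norm x)\<^sup>2) powr a) * indicator ?B x \<partial>lebesgue)"
    by (subst nn_integral_restrict_space) auto
  also have "\<dots> \<le> (\<integral>\<^sup>+x. (\<Sum>j. ennreal (q ^ Suc j) * indicator (A j) x) \<partial>lebesgue)"
  proof (rule nn_integral_mono)
    fix x :: 'a
    show "ennreal ((1 - (norm x)\<^sup>2) powr a) * indicator ?B x \<le> (\<Sum>j. ennreal (q ^ Suc j) * indicator (A j) x)"
    proof (cases "x \<in> ?B")
      case True
      then obtain j where j: "(1/2) ^ Suc j < 1 - norm x" "1 - norm x \<le> (1/2) ^ j"
        using dyadic_bracket[of "1 - norm x"] by auto
      have "ennreal ((1 - (norm x)\<^sup>2) powr a) * indicator ?B x \<le> ennreal (q ^ Suc j)"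
        using pow[of x j] True j by (simp add: ennreal_leI)
      also have "\<dots> = (\<Sum>j\<in>{j}. ennreal (q ^ Suc j) * indicator (A j) x)"
        using True j by (simp add: A_def)
      also have "\<dots> \<le> (\<Sum>j. ennreal (q ^ Suc j) * indicator (A j) x)"
        by (intro sum_le_suminf) auto
      finally show ?thesis .
    qed simp
  qed
  also have "\<dots> = (\<Sum>j. ennreal (q ^ Suc j) * emeasure lebesgue (A j))"
    using A by (subst nn_integral_suminf) (auto simp: nn_integral_cmult_indicator)
  also have "\<dots> \<le> (\<Sum>j. ennreal (q * \<omega> * real DIM('a) * (q / 2) ^ j))"
  proof (intro suminf_le summableI)
    fix j
    have "A j \<in> lmeasurable" by (auto simp: A_def)
    hence "emeasure lebesgue (A j) = ennreal (measure lebesgue (A j))"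
      by (simp add: emeasure_eq_measure2)
    also have "\<dots> \<le> ennreal (\<omega> * (real DIM('a) * (1/2) ^ j))"
      unfolding A_def \<omega>_def
      using content_ball_shell_le[of "1 - (1/2) ^ j", where 'a = 'a]
      by (intro ennreal_leI) (simp add: power_le_one)
    finally have "ennreal (q ^ Suc j) * emeasure lebesgue (A j)
        \<le> ennreal (q ^ Suc j) * ennreal (\<omega> * (real DIM('a) * (1/2) ^ j))"
      by (rule mult_left_mono) simp
    also have "\<dots> = ennreal (q * \<omega> * real DIM('a) * (q / 2) ^ j)"
      using q by (simp add: power_divide mult_ac \<omega>_def flip: ennreal_mult)
    finally show "ennreal (q ^ Suc j) * emeasure lebesgue (A j) \<le> ennreal (q * \<omega> * real DIM('a) * (q / 2) ^ j)" .
  qed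
  also have "\<dots> < \<infinity>"
  proof -
    have "summable (\<lambda>j. q * \<omega> * real DIM('a) * (q / 2) ^ j)"
      using q by (intro summable_mult summable_geometric) auto
    thus ?thesis
      using q by (subst suminf_ennreal2) (auto simp: \<omega>_def)
  qed
  finally show ?thesis
    by (intro integrableI_bounded borel_measurable_ball_weight) simp
qed

lemma ball_measure_eq_density:
  obtains \<kappa> where "\<kappa> > 0"
    "(ball_measure :: (real^'n) measure) = density (lebesgue_on (ball 0 1)) (\<lambda>_. ennreal \<kappa>)"
proof
  let ?B = "ball (0 :: real^'n) 1"
  define \<kappa> where "\<kappa> = 1 / measure lebesgue ?B"
  have pos: "measure lebesgue ?B > 0" using content_ball_pos[of 1 "0 :: real^'n"] by simp
  show "\<kappa> > 0" using pos by (simp add: \<kappa>_def)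
  have "emeasure (lebesgue_on ?B) ?B = ennreal (measure lebesgue ?B)"
    by (simp add: emeasure_restrict_space emeasure_eq_measure2)
  hence "1 / emeasure (lebesgue_on ?B) ?B = ennreal \<kappa>"
    using pos divide_ennreal[of 1 "measure lebesgue ?B"] by (simp add: \<kappa>_def)
  thus "(ball_measure :: (real^'n) measure) = density (lebesgue_on ?B) (\<lambda>_. ennreal \<kappa>)"
    unfolding ball_measure_def uniform_measure_def
    by (intro density_cong) (auto intro!: AE_I2 borel_measurable_indicator borel_measurable_divide_ennreal)
qed

text \<open>Positivity needs integrability of the weight: a divergent Bochner integral would be \<open>0\<close>.\<close>

lemma weight_const_pos: "weight_const TYPE('n::finite) a > 0"
proof (cases "a > -1")
  case True
  let ?L = "lebesgue_on (ball (0 :: real^'n) 1)"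
  let ?w = "\<lambda>x :: real^'n. (1 - (norm x)\<^sup>2) powr a"
  obtain \<kappa> where \<kappa>: "\<kappa> > 0" "(ball_measure :: (real^'n) measure) = density ?L (\<lambda>_. ennreal \<kappa>)"
    by (rule ball_measure_eq_density)
  have "weight_const TYPE('n) a = integral\<^sup>L (density ?L (\<lambda>_. ennreal \<kappa>)) ?w"
    using True by (simp add: weight_const_def \<kappa>(2))
  also have "\<dots> = integral\<^sup>L ?L (\<lambda>x. \<kappa> *\<^sub>R ?w x)"
    using \<kappa>(1) by (subst integral_density) (auto intro!: borel_measurable_ball_weight)
  also have "\<dots> = \<kappa> * integral\<^sup>L ?L ?w" by simp
  finally have eq: "weight_const TYPE('n) a = \<kappa> * integral\<^sup>L ?L ?w" .
  have "integral\<^sup>L ?L ?w \<noteq> 0"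
  proof
    assume "integral\<^sup>L ?L ?w = 0"
    hence "AE x in ?L. ?w x = 0"
      using integral_nonneg_eq_0_iff_AE[OF integrable_ball_weight[OF True, where 'a = "real^'n"]] by auto
    hence "AE x in ?L. False"
    proof (rule AE_mp, intro AE_I2 impI)
      fix x assume "x \<in> space ?L" "?w x = 0"
      thus False using norm_power2_less_1[of x] by simp
    qed
    moreover have "{x \<in> space ?L. \<not> False} = space ?L" by blast
    ultimately have "emeasure ?L (space ?L) = 0"
      by (subst (asm) AE_iff_measurable[OF sets.top]) blast
    hence "emeasure lebesgue (ball (0::real^'n) 1) = 0"
      by (simp add: emeasure_restrict_space)
    thus False using content_ball_pos[of 1 "0 :: real^'n"] by (simp add: measure_def)
  qed
  moreover have "integral\<^sup>L ?L ?w \<ge> 0" by simp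
  ultimately have "integral\<^sup>L ?L ?w > 0" by linarith
  thus ?thesis using \<kappa>(1) eq by simp
qed (simp add: weight_const_def)

lemma sets_weighted_measure: "sets (weighted_measure a :: (real^'n) measure) = sets (lebesgue_on (ball 0 1))"
  by (simp add: weighted_measure_def ball_measure_def)

text \<open>Both normalising constants are positive, so they drop out of integrability. Positivity
  of \<open>V\<close> matters: division by zero would turn the density into 0.\<close>

lemma integrable_weighted_measure_iff:
  fixes g :: "real^'n \<Rightarrow> real"
  assumes g: "g \<in> borel_measurable (lebesgue_on (ball 0 1))"
  shows "integrable (weighted_measure a) g \<longleftrightarrow>
    integrable (lebesgue_on (ball 0 1)) (\<lambda>x. (1 - (norm x)\<^sup>2) powr a * g x)"
proof -
  let ?L = "lebesgue_on (ball (0 :: real^'n) 1)"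
  obtain \<kappa> where \<kappa>: "\<kappa> > 0" "(ball_measure :: (real^'n) measure) = density ?L (\<lambda>_. ennreal \<kappa>)"
    by (rule ball_measure_eq_density)
  define V where "V = weight_const TYPE('n) a"
  have V: "V > 0" using weight_const_pos by (simp add: V_def)
  note [measurable] = borel_measurable_ball_weight[where 'a = "real^'n"] g
  have "integrable (weighted_measure a) g \<longleftrightarrow>
      integrable (density ?L (\<lambda>_. ennreal \<kappa>)) (\<lambda>x. ((1 - (norm x)\<^sup>2) powr a / V) *\<^sub>R g x)"
    unfolding weighted_measure_def \<kappa>(2) V_def[symmetric]
    using V by (intro integrable_density) (auto intro!: AE_I2)
  also have "\<dots> \<longleftrightarrow> integrable ?L (\<lambda>x. \<kappa> *\<^sub>R (((1 - (norm x)\<^sup>2) powr a / V) *\<^sub>R g x))"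
    using \<kappa>(1) by (intro integrable_density) (auto intro!: AE_I2)
  also have "\<dots> \<longleftrightarrow> integrable ?L (\<lambda>x. (\<kappa> / V) * ((1 - (norm x)\<^sup>2) powr a * g x))"
    by (simp add: mult_ac)
  also have "\<dots> \<longleftrightarrow> integrable ?L (\<lambda>x. (1 - (norm x)\<^sup>2) powr a * g x)"
    using \<kappa>(1) V by (subst integrable_mult_left_iff) simp
  finally show ?thesis .
qed

subsection \<open>Decay at the boundary\<close>

lemma powr_le_of_comparable:
  fixes X Y \<beta> :: real
  assumes "0 < X" "0 < Y" "X \<le> 4 * Y" "Y \<le> 4 * X"
  shows "X powr \<beta> \<le> 4 powr \<bar>\<beta>\<bar> * Y powr \<beta>"
proof (cases "\<beta> \<ge> 0")
  case True
  have "X powr \<beta> \<le> (4 * Y) powr \<beta>" using assms True by (intro powr_mono2) auto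
  thus ?thesis using assms True by (simp add: powr_mult)
next
  case False
  have "X powr \<beta> \<le> (Y / 4) powr \<beta>" using assms False by (intro powr_mono2') auto
  also have "\<dots> = 4 powr \<bar>\<beta>\<bar> * Y powr \<beta>"
    using assms False by (simp add: powr_divide powr_minus_divide)
  finally show ?thesis .
qed

text \<open>On this ball \<open>1 - norm y\<close> lies between one half and three halves of
  \<open>1 - norm x\<close>, while \<open>1 - (norm z)\<^sup>2\<close> lies between
  \<open>1 - norm z\<close> and twice that. The constant 4 covers both combinations.\<close>

lemma half_distance_ball_comparable:
  fixes x y :: "'a::real_normed_vector"
  assumes x: "norm x < 1" and y: "y \<in> cball x ((1 - norm x) / 2)"
  shows "norm y < 1" "(3 * norm x - 1) / 2 \<le> norm y"
    "1 - (norm x)\<^sup>2 \<le> 4 * (1 - (norm y)\<^sup>2)" "1 - (norm y)\<^sup>2 \<le> 4 * (1 - (norm x)\<^sup>2)"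
proof -
  have d: "\<bar>norm x - norm y\<bar> \<le> (1 - norm x) / 2"
    using norm_triangle_ineq3[of x y] y by (simp add: dist_norm)
  show y1: "norm y < 1" using d x by argo
  show "(3 * norm x - 1) / 2 \<le> norm y" using d x by argo
  have bounds: "1 - norm z \<le> 1 - (norm z)\<^sup>2" "1 - (norm z)\<^sup>2 \<le> 2 * (1 - norm z)" if "norm z < 1" for z :: 'a
  proof -
    show "1 - norm z \<le> 1 - (norm z)\<^sup>2"
      using that by (simp add: power2_eq_square mult_left_le)
    show "1 - (norm z)\<^sup>2 \<le> 2 * (1 - norm z)"
      using zero_le_power2[of "1 - norm z"] by (simp add: power2_eq_square algebra_simps)
  qed
  show "1 - (norm x)\<^sup>2 \<le> 4 * (1 - (norm y)\<^sup>2)" "1 - (norm y)\<^sup>2 \<le> 4 * (1 - (norm x)\<^sup>2)"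
    using bounds[OF x] bounds[OF y1] d x by (argo, argo)
qed

text \<open>The local bound is applied at radius half the distance to the sphere. Comparability
  moves the weight under the integral, and \<open>r ^ n\<close>, at least a constant times
  \<open>(1 - (norm x)\<^sup>2) ^ n\<close>, raises the exponent from \<beta> to
  \<open>\<beta> + n\<close>. Integrating over the whole outer shell makes the bound depend on
  \<open>norm x\<close> only.\<close>

lemma weighted_mean_value_bound:
  fixes u :: "'a::euclidean_space \<Rightarrow> complex" and p \<beta> :: real
  defines "h \<equiv> \<lambda>y. (1 - (norm y)\<^sup>2) powr \<beta> * norm (u y) powr p"
  assumes p: "p > 0" and cont: "continuous_on (ball 0 1) u"
    and mv: "\<And>y \<delta>. \<lbrakk>\<delta> > 0; cball y (\<delta> * (2 * real DIM('a))) \<subseteq> ball 0 1\<rbrakk> \<Longrightarrow>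
       integral (cbox (- (2 *\<^sub>R One)) (2 *\<^sub>R One)) (\<lambda>z. bump z *\<^sub>R u (y + \<delta> *\<^sub>R z))
         = integral (cbox (- (2 *\<^sub>R One)) (2 *\<^sub>R One)) (bump :: 'a \<Rightarrow> real) *\<^sub>R u y"
    and int: "integrable (lebesgue_on (ball 0 1)) h"
  shows "\<exists>C>0. \<forall>x. norm x < 1 \<longrightarrow> (1 - (norm x)\<^sup>2) powr (\<beta> + real DIM('a)) * norm (u x) powr p
       \<le> C * (LINT y|lebesgue_on (ball 0 1). indicator {y. (3 * norm x - 1) / 2 \<le> norm y} y * h y)"
proof -
  let ?n = "DIM('a)"
  let ?L = "lebesgue_on (ball (0::'a) 1)"
  obtain C0 where C0: "C0 > 0"
    "\<forall>(u :: 'a \<Rightarrow> complex) x r. r > 0 \<longrightarrow> continuous_on (cball x r) u \<longrightarrow>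
       (\<forall>y \<delta>. \<delta> > 0 \<longrightarrow> cball y (\<delta> * (2 * real ?n)) \<subseteq> cball x r \<longrightarrow>
          integral (cbox (- (2 *\<^sub>R One)) (2 *\<^sub>R One)) (\<lambda>z. bump z *\<^sub>R u (y + \<delta> *\<^sub>R z))
            = integral (cbox (- (2 *\<^sub>R One)) (2 *\<^sub>R One)) (bump :: 'a \<Rightarrow> real) *\<^sub>R u y) \<longrightarrow>
       (\<exists>a b. cbox a b \<subseteq> cball x r \<and>
         norm (u x) powr p * r ^ ?n \<le> C0 * integral (cbox a b) (\<lambda>z. norm (u z) powr p))"
    using mean_value_imp_powr_bound[where 'a = 'a, OF p] by blast
  define C where "C = 4 ^ ?n * C0 * 4 powr \<bar>\<beta>\<bar>"
  show ?thesis
  proof (rule exI, intro conjI allI impI)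
    show "C > 0" using C0(1) by (simp add: C_def)
    fix x :: 'a assume x: "norm x < 1"
    define r where "r = (1 - norm x) / 2"
    define X where "X = 1 - (norm x)\<^sup>2"
    define A where "A = {y :: 'a. (3 * norm x - 1) / 2 \<le> norm y}"
    have r: "r > 0" using x by (simp add: r_def)
    have X: "X > 0" using norm_power2_less_1[OF x] by (simp add: X_def)
    have X4: "X \<le> 4 * r"
      using zero_le_power2[of "1 - norm x"] by (simp add: X_def r_def power2_eq_square algebra_simps)
    have near: "norm y < 1" "y \<in> A" "X powr \<beta> * norm (u y) powr p \<le> 4 powr \<bar>\<beta>\<bar> * h y"
      if "y \<in> cball x r" for y
    proof -
      note c = half_distance_ball_comparable[OF x that[unfolded r_def]]
      show "norm y < 1" "y \<in> A" using c(1,2) by (simp_all add: A_def)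
      have "X powr \<beta> \<le> 4 powr \<bar>\<beta>\<bar> * (1 - (norm y)\<^sup>2) powr \<beta>"
        using X norm_power2_less_1[OF c(1)] c(3,4) unfolding X_def by (intro powr_le_of_comparable) auto
      hence "X powr \<beta> * norm (u y) powr p \<le> 4 powr \<bar>\<beta>\<bar> * (1 - (norm y)\<^sup>2) powr \<beta> * norm (u y) powr p"
        by (rule mult_right_mono) simp
      thus "X powr \<beta> * norm (u y) powr p \<le> 4 powr \<bar>\<beta>\<bar> * h y"
        by (simp add: h_def mult_ac)
    qed
    have sub: "cball x r \<subseteq> ball 0 1" using near(1) by auto
    have "\<exists>a b. cbox a b \<subseteq> cball x r \<and>
         norm (u x) powr p * r ^ ?n \<le> C0 * integral (cbox a b) (\<lambda>z. norm (u z) powr p)"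
      by (rule C0(2)[rule_format, OF r continuous_on_subset[OF cont sub]]) (rule mv[OF _ subset_trans[OF _ sub]])
    then obtain a b where ab: "cbox a b \<subseteq> cball x r"
      and bound: "norm (u x) powr p * r ^ ?n \<le> C0 * integral (cbox a b) (\<lambda>z. norm (u z) powr p)"
      by blast
    have cu: "continuous_on (cbox a b) u"
      using continuous_on_subset[OF cont] ab sub by blast
    have cp: "continuous_on (cbox a b) (\<lambda>z. norm (u z) powr p)"
      by (rule continuous_on_powr') (use cu p in \<open>auto intro!: continuous_intros\<close>)
    have nz: "1 - (norm z)\<^sup>2 \<noteq> 0" if "z \<in> cbox a b" for z
      using norm_power2_less_1[of z] near(1) ab that by force
    have "continuous_on (cbox a b) (\<lambda>z. (1 - (norm z)\<^sup>2) powr \<beta>)"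
      using nz by (intro continuous_on_powr continuous_intros) auto
    hence ch: "continuous_on (cbox a b) h"
      unfolding h_def by (intro continuous_on_mult cp)
    let ?g = "\<lambda>y. indicator A y * h y"
    have A: "A \<in> sets borel"
      unfolding A_def by (intro borel_closed closed_Collect_le continuous_intros)
    have "A \<inter> ball 0 1 \<in> sets ?L"
      using A by (simp add: sets_restrict_space image_iff) (metis Int_commute sets_completionI_sets sets_lborel)
    hence "integrable ?L (\<lambda>y. indicator (A \<inter> ball 0 1) y *\<^sub>R h y)"
      by (rule integrable_mult_indicator[OF _ int])
    hence "integrable ?L ?g"
      by (rule Bochner_Integration.integrable_cong[THEN iffD1, rotated 2]) (auto simp: indicator_def)
    \<comment> \<open>The hypothesis concerns a Lebesgue integral over the open ball, the local
      bound a gauge integral over a box; for the integrable \<open>?g\<close> the two notions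
      agree.\<close>
    hence g: "?g integrable_on ball 0 1" "integral\<^sup>L ?L ?g = integral (ball 0 1) ?g"
      by (auto intro: integrable_on_lebesgue_on lebesgue_integral_eq_integral)
    have gh: "?g y = h y" if "y \<in> cbox a b" for y
      using near(2) ab that by auto
    have "X powr \<beta> * integral (cbox a b) (\<lambda>z. norm (u z) powr p)
        = integral (cbox a b) (\<lambda>z. X powr \<beta> * norm (u z) powr p)"
      by simp
    also have "\<dots> \<le> integral (cbox a b) (\<lambda>z. 4 powr \<bar>\<beta>\<bar> * h z)"
      using near(3) ab by (intro integral_le integrable_continuous continuous_intros cp ch) auto
    also have "\<dots> = 4 powr \<bar>\<beta>\<bar> * integral (cbox a b) h"
      by simp
    \<comment> \<open>The box lies in the shell \<open>A\<close>, so the indicator is 1 on it;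
      nonnegativity of \<open>?g\<close> then permits enlarging the box to the ball.\<close>
    also have "integral (cbox a b) h = integral (cbox a b) ?g"
      by (rule integral_cong) (rule gh[symmetric])
    also have "integral (cbox a b) ?g \<le> integral (ball 0 1) ?g"
    proof (rule integral_subset_le)
      show "?g integrable_on cbox a b"
        using integrable_continuous[OF ch] by (rule integrable_eq) (use gh in simp)
    qed (use ab sub g in \<open>auto simp: h_def\<close>)
    finally have main: "X powr \<beta> * integral (cbox a b) (\<lambda>z. norm (u z) powr p)
        \<le> 4 powr \<bar>\<beta>\<bar> * integral\<^sup>L ?L ?g"
      using g(2) by simp
    have "X powr (\<beta> + real ?n) * norm (u x) powr p = X powr \<beta> * (X ^ ?n * norm (u x) powr p)"
      using X by (simp add: powr_add powr_realpow)
    also have "\<dots> \<le> X powr \<beta> * ((4 * r) ^ ?n * norm (u x) powr p)"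
      using X X4 by (intro mult_left_mono mult_right_mono power_mono) auto
    also have "\<dots> = 4 ^ ?n * X powr \<beta> * (norm (u x) powr p * r ^ ?n)"
      by (simp add: power_mult_distrib)
    also have "\<dots> \<le> 4 ^ ?n * X powr \<beta> * (C0 * integral (cbox a b) (\<lambda>z. norm (u z) powr p))"
      by (intro mult_left_mono bound) auto
    also have "\<dots> = 4 ^ ?n * C0 * (X powr \<beta> * integral (cbox a b) (\<lambda>z. norm (u z) powr p))"
      by simp
    also have "\<dots> \<le> 4 ^ ?n * C0 * (4 powr \<bar>\<beta>\<bar> * integral\<^sup>L ?L ?g)"
      using C0(1) by (intro mult_left_mono main) auto
    finally show "(1 - (norm x)\<^sup>2) powr (\<beta> + real ?n) * norm (u x) powr p
       \<le> C * (LINT y|?L. indicator {y. (3 * norm x - 1) / 2 \<le> norm y} y * h y)"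
      by (simp add: C_def X_def A_def mult.assoc)
  qed
qed

text \<open>The shells \<open>norm y \<ge> \<rho> k\<close> shrink to the empty set within the open
  ball, so dominated convergence with majorant \<open>h\<close> applies. Monotonicity in \<sigma>
  extends one good radius to all larger ones.\<close>

lemma integral_outer_shell_small:
  fixes h :: "'a::euclidean_space \<Rightarrow> real"
  assumes int: "integrable (lebesgue_on (ball 0 1)) h" and nonneg: "\<And>y. 0 \<le> h y" and e: "e > 0"
  obtains \<rho> where "\<rho> < 1"
    "\<And>\<sigma>. \<rho> \<le> \<sigma> \<Longrightarrow> (LINT y|lebesgue_on (ball 0 1). indicator {y. \<sigma> \<le> norm y} y * h y) < e"
proof -
  let ?L = "lebesgue_on (ball (0::'a) 1)"
  define \<rho> where "\<rho> = (\<lambda>k::nat. 1 - inverse (real (Suc k)))"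
  have lim: "\<rho> \<longlonglongrightarrow> 1"
    using LIMSEQ_inverse_real_of_nat_add_minus[of 1] by (simp add: \<rho>_def)
  have meas: "(\<lambda>y::'a. indicator {y. \<sigma> \<le> norm y} y :: real) \<in> borel_measurable ?L" for \<sigma> :: real
    by (intro measurable_restrict_space1 measurable_completion) measurable
  have meas_h: "(\<lambda>y. indicator {y. \<sigma> \<le> norm y} y * h y) \<in> borel_measurable ?L" for \<sigma>
    using meas int by (intro borel_measurable_times) auto
  have int': "integrable ?L (\<lambda>y. indicator {y. \<sigma> \<le> norm y} y * h y)" for \<sigma>
    by (rule Bochner_Integration.integrable_bound[OF int meas_h]) (auto simp: indicator_def nonneg)
  have "(\<lambda>k. LINT y|?L. indicator {y. \<rho> k \<le> norm y} y * h y) \<longlonglongrightarrow> (LINT y|?L. 0)"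
  proof (rule integral_dominated_convergence[where w = h])
    show "AE y in ?L. (\<lambda>k. indicator {y. \<rho> k \<le> norm y} y * h y) \<longlonglongrightarrow> 0"
    proof (rule AE_I2)
      fix y assume "y \<in> space ?L"
      hence "norm y < 1" by simp
      hence "\<forall>\<^sub>F k in sequentially. norm y < \<rho> k"
        using order_tendstoD(1)[OF lim] by blast
      hence "\<forall>\<^sub>F k in sequentially. indicator {y. \<rho> k \<le> norm y} y * h y = 0"
        by eventually_elim simp
      thus "(\<lambda>k. indicator {y. \<rho> k \<le> norm y} y * h y) \<longlonglongrightarrow> 0"
        by (rule tendsto_eventually)
    qed
    show "AE y in ?L. norm (indicator {y. \<rho> k \<le> norm y} y * h y) \<le> h y" for k
      by (rule AE_I2) (simp add: indicator_def nonneg)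
  qed (simp_all only: meas_h int borel_measurable_const)
  hence "\<forall>\<^sub>F k in sequentially. (LINT y|?L. indicator {y. \<rho> k \<le> norm y} y * h y) < e"
    using e by (intro order_tendstoD(2)) auto
  then obtain k where k: "(LINT y|?L. indicator {y. \<rho> k \<le> norm y} y * h y) < e"
    by (auto simp: eventually_sequentially)
  show ?thesis
  proof (rule that)
    show "\<rho> k < 1" by (simp add: \<rho>_def)
    fix \<sigma> assume "\<rho> k \<le> \<sigma>"
    hence "(LINT y|?L. indicator {y. \<sigma> \<le> norm y} y * h y) \<le> (LINT y|?L. indicator {y. \<rho> k \<le> norm y} y * h y)"
      by (intro integral_mono int') (auto simp: indicator_def nonneg)
    thus "(LINT y|?L. indicator {y. \<sigma> \<le> norm y} y * h y) < e" using k by simp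
  qed
qed

theorem theorem1p1:
  fixes \<alpha> p :: real
  assumes "CARD('n::finite) \<ge> 2" and "p > 0"
  shows "(bergman_besov p (p * \<alpha> - real CARD('n)) :: (real^'n \<Rightarrow> complex) set) \<subseteq> little_bloch \<alpha>"
proof
  fix f :: "real^'n \<Rightarrow> complex"
  let ?n = "CARD('n)" and ?L = "lebesgue_on (ball (0 :: real^'n) 1)"
  assume "f \<in> bergman_besov p (p * \<alpha> - real ?n)"
  then obtain F s t where harm: "harmonic_on (ball 0 1) f" and F: "homogeneous_expansion f F"
    and st: "p * \<alpha> - real ?n + p * t > -1"
    and Lp: "I_op s t F \<in> Lp_class p (weighted_measure (p * \<alpha> - real ?n))"
    unfolding bergman_besov_def by blast
  define u where "u = D_op s t F"
  define c where "c = (\<lambda>k. gamma_coeff ?n (s + t) k / gamma_coeff ?n s k)"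
  \<comment> \<open>\<beta> collects the exponent \<open>p * \<alpha> - n\<close> of the measure and
    \<open>p * t\<close> from \<open>I_op\<close>; then \<open>\<beta> + n\<close> is exactly the
    exponent of the weight in \<open>v x powr p\<close>.\<close>
  define \<beta> where "\<beta> = p * (\<alpha> + t) - real ?n"
  define h where "h = (\<lambda>y. (1 - (norm y)\<^sup>2) powr \<beta> * norm (u y) powr p)"
  define v where "v = (\<lambda>x. (1 - (norm x)\<^sup>2) powr \<alpha> * norm (I_op s t F x))"
  have p: "p > 0" by fact
  have "p * (\<alpha> + t) > 0" using st assms(1) by (simp add: distrib_left)
  hence \<alpha>t: "\<alpha> + t > 0" using p by (simp add: zero_less_mult_iff)
  have c: "summable (\<lambda>k. \<bar>c k\<bar> * q ^ k)" if "0 \<le> q" "q < 1" for q :: real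
    unfolding c_def using that by (intro summable_gamma_coeff_quotient) auto
  have u_eq: "u = (\<lambda>x. \<Sum>k. of_real (c k) * F k x)"
    unfolding u_def D_op_def c_def ..
  have cont: "continuous_on (ball 0 1) u"
    unfolding u_eq by (rule continuous_on_homogeneous_expansion_multiplier[OF F c])
  have mv: "integral (cbox (- (2 *\<^sub>R One)) (2 *\<^sub>R One)) (\<lambda>z. bump z *\<^sub>R u (y + \<delta> *\<^sub>R z))
         = integral (cbox (- (2 *\<^sub>R One)) (2 *\<^sub>R One)) (bump :: real^'n \<Rightarrow> real) *\<^sub>R u y"
    if \<delta>: "\<delta> > 0" and sub: "cball y (\<delta> * (2 * real DIM(real^'n))) \<subseteq> ball 0 1" for y \<delta>
  proof -
    have "norm y + \<delta> * (2 * real DIM(real^'n)) < 1"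
      using sub \<delta> by (auto simp: cball_subset_ball_iff mult_less_0_iff)
    thus ?thesis
      unfolding u_eq using \<delta> by (intro homogeneous_expansion_multiplier_mean_value[OF F c]) auto
  qed
  have meas: "I_op s t F \<in> borel_measurable ?L"
    using Lp by (simp add: Lp_class_def measurable_cong_sets[OF sets_weighted_measure refl])
  have Ip: "norm (I_op s t F y) powr p = (1 - (norm y)\<^sup>2) powr (p * t) * norm (u y) powr p" for y
    by (simp add: I_op_def u_def norm_mult powr_mult powr_powr mult.commute)
  have "integrable (weighted_measure (p * \<alpha> - real ?n)) (\<lambda>y. norm (I_op s t F y) powr p)"
    using Lp by (simp add: Lp_class_def)
  hence "integrable ?L (\<lambda>y. (1 - (norm y)\<^sup>2) powr (p * \<alpha> - real ?n) * norm (I_op s t F y) powr p)"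
    using meas by (subst (asm) integrable_weighted_measure_iff) measurable
  also have "(\<lambda>y. (1 - (norm y)\<^sup>2) powr (p * \<alpha> - real ?n) * norm (I_op s t F y) powr p) = h"
    by (auto simp: Ip h_def \<beta>_def algebra_simps simp flip: powr_add)
  finally have int: "integrable ?L h" .
  have vp: "v x powr p = (1 - (norm x)\<^sup>2) powr (\<beta> + real DIM(real^'n)) * norm (u x) powr p" for x
    unfolding v_def by (simp add: powr_mult Ip powr_powr \<beta>_def distrib_left powr_add mult_ac)
  obtain C where C: "C > 0"
    "\<And>x. norm x < 1 \<Longrightarrow> v x powr p \<le> C * (LINT y|?L. indicator {y. (3 * norm x - 1) / 2 \<le> norm y} y * h y)"
    unfolding vp h_def using weighted_mean_value_bound[OF p cont mv int[unfolded h_def]] by blast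
  have h_nonneg: "0 \<le> h y" for y by (simp add: h_def)
  have v_nonneg: "0 \<le> v x" for x by (simp add: v_def)
  have v_root: "v x = (v x powr p) powr (1 / p)" for x
    using p v_nonneg by (simp add: powr_powr)

  have "((\<lambda>x. v x powr p) \<longlongrightarrow> 0) (filtercomap norm (at_left 1))"
  proof (rule order_tendstoI)
    fix e :: real assume "e > 0"
    then obtain \<rho> where \<rho>: "\<rho> < 1"
      "\<And>\<sigma>. \<rho> \<le> \<sigma> \<Longrightarrow> (LINT y|?L. indicator {y. \<sigma> \<le> norm y} y * h y) < e / C"
      using integral_outer_shell_small[OF int h_nonneg, of "e / C"] C(1) by auto
    \<comment> \<open>The threshold solves \<open>(3 * r - 1) / 2 = \<rho>\<close>: beyond it the
      shell attached to \<open>x\<close> has inner radius at least \<rho>.\<close>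
    have "\<forall>\<^sub>F r :: real in at_left 1. (2 * \<rho> + 1) / 3 < r \<and> r < 1"
      using \<rho>(1) by (intro eventually_at_leftI[of "(2 * \<rho> + 1) / 3"]) auto
    moreover have "v x powr p < e" if "(2 * \<rho> + 1) / 3 < norm x \<and> norm x < 1" for x
    proof -
      have "\<rho> \<le> (3 * norm x - 1) / 2" using that by (simp add: field_simps)
      hence "C * (LINT y|?L. indicator {y. (3 * norm x - 1) / 2 \<le> norm y} y * h y) < C * (e / C)"
        using C(1) by (intro mult_strict_left_mono \<rho>(2))
      thus ?thesis using C(2)[of x] C(1) that by simp
    qed
    ultimately show "\<forall>\<^sub>F x in filtercomap norm (at_left 1). v x powr p < e"
      unfolding eventually_filtercomap by blast
  next
    fix e :: real assume "e < 0"
    thus "\<forall>\<^sub>F x in filtercomap norm (at_left 1). e < v x powr p"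
      by (intro always_eventually allI) (rule less_le_trans, auto)
  qed
  \<comment> \<open>All estimates concern \<open>v x powr p\<close>; as \<open>v\<close> is
    nonnegative, taking the \<open>p\<close>-th root recovers \<open>v\<close>.\<close>
  hence "((\<lambda>x. (v x powr p) powr (1 / p)) \<longlongrightarrow> 0 powr (1 / p)) (filtercomap norm (at_left 1))"
    using p by (intro tendsto_powr') (auto intro!: always_eventually)
  hence lim: "(v \<longlongrightarrow> 0) (filtercomap norm (at_left 1))"
    by (simp flip: v_root)

  \<comment> \<open>The limit controls \<open>v\<close> only near the sphere, whereas membership in
    \<open>bloch\<close> asks for a bound on the whole ball. Bounding each shell integral by the
    full integral of \<open>h\<close> provides it.\<close>
  define M where "M = (C * integral\<^sup>L ?L h) powr (1 / p)"
  have bound: "v x \<le> M" if x: "norm x < 1" for x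
  proof -
    have "(LINT y|?L. indicator {y. (3 * norm x - 1) / 2 \<le> norm y} y * h y) \<le> integral\<^sup>L ?L h"
      by (rule integral_mono'[OF int]) (auto simp: indicator_def h_nonneg)
    hence "v x powr p \<le> C * integral\<^sup>L ?L h"
      using C(2)[OF x] C(1) by (meson mult_left_mono less_imp_le order_trans)
    thus ?thesis
      unfolding M_def using p by (subst v_root, intro powr_mono2) auto
  qed
  have "I_op s t F \<in> weighted_Linf \<alpha>"
    unfolding weighted_Linf_def Linf_class_def
  proof (intro CollectI conjI exI)
    have sets: "sets (ball_measure :: (real^'n) measure) = sets ?L"
      by (simp add: ball_measure_def)
    have "(\<lambda>x. of_real ((1 - (norm x)\<^sup>2) powr \<alpha>) * I_op s t F x) \<in> borel_measurable ?L"
      by (intro borel_measurable_times meas measurable_compose[OF borel_measurable_ball_weight]) measurable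
    thus "(\<lambda>x. of_real ((1 - (norm x)\<^sup>2) powr \<alpha>) * I_op s t F x) \<in> borel_measurable ball_measure"
      by (simp only: measurable_cong_sets[OF sets refl])
    show "AE x in ball_measure. norm (of_real ((1 - (norm x)\<^sup>2) powr \<alpha>) * I_op s t F x) \<le> M"
    proof (rule AE_I2)
      fix x :: "real^'n" assume "x \<in> space ball_measure"
      hence "norm x < 1" by (simp add: ball_measure_def)
      from bound[OF this] show "norm (of_real ((1 - (norm x)\<^sup>2) powr \<alpha>) * I_op s t F x) \<le> M"
        by (simp add: v_def norm_mult)
    qed
  qed
  with harm F \<alpha>t have "f \<in> bloch \<alpha>" unfolding bloch_def by blast
  thus "f \<in> little_bloch \<alpha>"
    using F \<alpha>t lim unfolding little_bloch_def v_def by blast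
qed

end
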